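(* Let $E,A\in\mathbb{R}^{n\times n}$ with $\operatorname{rank}(E)=r$. Then the pair $(E,A)$ is admissible if and only if there exist invertible matrices $T,W\in\mathbb{R}^{n\times n}$ and matrices $S,U,B\in\mathbb{R}^{r\times r}$ with $S$ invertible, $U^TU=I_r$, $B$ symmetric positive semidefinite and $\|B\|\le 1$, such that $$E=W\begin{bmatrix} I_r&0\\0&0\end{bmatrix}T,\qquad A=W\begin{bmatrix} S^{-1}UBS&0\\0&I_{n-r}\end{bmatrix}T.$$
   Context: A pair $(E,A)$ of real $n\times n$ matrices is regular if $\det(\lambda E-A)$ is not identically zero as a polynomial in $\lambda$. For a regular pair, the finite eigenvalues are the roots of $\det(zE-A)$. A regular pair admits a Weierstrass canonical form $E=W\operatorname{diag}(I_q,N)T$, $A=W\operatorname{diag}(J,I_{n-q})T$ with $W,T$ nonsingular, $J$ in Jordan form and $N$ nilpotent in Jordan form; if $q<n$ the index of the pair is the nilpotency degree $\nu$ of $N$ (smallest $\nu\ge1$ with $N^\nu=0$), and the index is $0$ if $E$ is nonsingular. The pair is stable if all finite eigenvalues lie in the closed unit disk and those on the unit circle are semisimple. The pair is admissible if it is regular, of index at most one, and stable. $\|\cdot\|$ is the spectral norm. *)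

theory Defs
  imports "Jordan_Normal_Form.Matrix_Kernel" "Jordan_Normal_Form.DL_Rank"
          "HOL-Computational_Algebra.Polynomial"
begin

definition pencil_poly :: "real mat \<Rightarrow> real mat \<Rightarrow> real poly" where
  "pencil_poly E A = det (map_mat (\<lambda>e. [:0, e:]) E - map_mat (\<lambda>a. [:a:]) A)"

definition regular_pair :: "real mat \<Rightarrow> real mat \<Rightarrow> bool" where
  "regular_pair E A \<longleftrightarrow> pencil_poly E A \<noteq> 0"

definition finite_eigenvalue :: "real mat \<Rightarrow> real mat \<Rightarrow> complex \<Rightarrow> bool" where
  "finite_eigenvalue E A z \<longleftrightarrow> poly (map_poly complex_of_real (pencil_poly E A)) z = 0"

definition semisimple_eigenvalue :: "real mat \<Rightarrow> real mat \<Rightarrow> complex \<Rightarrow> bool" where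
  "semisimple_eigenvalue E A z \<longleftrightarrow>
     order z (map_poly complex_of_real (pencil_poly E A)) =
     kernel_dim (z \<cdot>\<^sub>m map_mat complex_of_real E - map_mat complex_of_real A)"

definition stable_pair :: "real mat \<Rightarrow> real mat \<Rightarrow> bool" where
  "stable_pair E A \<longleftrightarrow>
     (\<forall>z. finite_eigenvalue E A z \<longrightarrow> cmod z \<le> 1) \<and>
     (\<forall>z. finite_eigenvalue E A z \<and> cmod z = 1 \<longrightarrow> semisimple_eigenvalue E A z)"

definition weierstrass_form ::
  "nat \<Rightarrow> real mat \<Rightarrow> real mat \<Rightarrow> nat \<Rightarrow> real mat \<Rightarrow> real mat \<Rightarrow> real mat \<Rightarrow> real mat \<Rightarrow> bool" where
  "weierstrass_form n E A q W T J N \<longleftrightarrow>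
     q \<le> n \<and> W \<in> carrier_mat n n \<and> T \<in> carrier_mat n n \<and>
     invertible_mat W \<and> invertible_mat T \<and>
     J \<in> carrier_mat q q \<and> N \<in> carrier_mat (n - q) (n - q) \<and>
     (\<exists>k. N ^\<^sub>m k = 0\<^sub>m (n - q) (n - q)) \<and>
     E = W * four_block_mat (1\<^sub>m q) (0\<^sub>m q (n - q)) (0\<^sub>m (n - q) q) N * T \<and>
     A = W * four_block_mat J (0\<^sub>m q (n - q)) (0\<^sub>m (n - q) q) (1\<^sub>m (n - q)) * T"

definition pair_has_index :: "nat \<Rightarrow> real mat \<Rightarrow> real mat \<Rightarrow> nat \<Rightarrow> bool" where
  "pair_has_index n E A \<nu> \<longleftrightarrow>
     (invertible_mat E \<and> \<nu> = 0) \<or>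
     (\<not> invertible_mat E \<and>
      (\<exists>q W T J N. weierstrass_form n E A q W T J N \<and> q < n \<and>
         \<nu> = (LEAST k. 1 \<le> k \<and> N ^\<^sub>m k = 0\<^sub>m (n - q) (n - q))))"

definition admissible_pair :: "nat \<Rightarrow> real mat \<Rightarrow> real mat \<Rightarrow> bool" where
  "admissible_pair n E A \<longleftrightarrow>
     regular_pair E A \<and> (\<exists>\<nu>. pair_has_index n E A \<nu> \<and> \<nu> \<le> 1) \<and> stable_pair E A"

definition vec_norm2 :: "real vec \<Rightarrow> real" where
  "vec_norm2 x = sqrt (x \<bullet> x)"

definition spectral_norm :: "real mat \<Rightarrow> real" where
  "spectral_norm B = Sup {vec_norm2 (B *\<^sub>v x) | x. x \<in> carrier_vec (dim_col B) \<and> vec_norm2 x \<le> 1}"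

definition sym_psd :: "real mat \<Rightarrow> bool" where
  "sym_psd B \<longleftrightarrow> B\<^sup>T = B \<and> (\<forall>x \<in> carrier_vec (dim_col B). 0 \<le> x \<bullet> (B *\<^sub>v x))"

end

theory Submission
  imports Defs "Jordan_Normal_Form.Jordan_Normal_Form_Existence"
    "Jordan_Normal_Form.Jordan_Normal_Form_Uniqueness"
    "HOL-Analysis.Function_Topology" "HOL-Analysis.Convex"
begin

text \<open>The index condition says that \<open>N = 0\<close> in the Weierstrass form, so the pair is equivalent to
\<open>(diag(I, 0), diag(J, I))\<close>, where \<open>I\<close> has size \<open>rank E\<close>, and its stability is that of \<open>J\<close>.
Rescaling the Jordan blocks of a stable \<open>J\<close> by powers of \<open>1 - |a|\<close> gives a complex contraction
\<open>D\<close> with \<open>Q J = D Q\<close>. The form \<open>|Q x|^2\<close> restricted to real \<open>x\<close> is a real positive definite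
quadratic form, hence equal to \<open>|S x|^2\<close> for a real invertible \<open>S\<close>, and \<open>M = S J S^-1\<close> is a
real contraction; its polar decomposition is \<open>U B\<close>, where \<open>U\<close> maximises \<open>tr (U^T M)\<close> over
the compact set of orthogonal matrices. Conversely a contraction has its spectrum in
the disk, and on the unit circle a Jordan chain \<open>D w = z w + u\<close>, \<open>D u = z u\<close> would make
\<open>D^k w\<close> grow linearly.\<close>

unbundle no inner_syntax

section \<open>Positive definite quadratic forms\<close>

text \<open>Cholesky factorisation by completing the square in the last variable: with
  \<open>a = P n n\<close> and \<open>L x\<close> the coefficient of \<open>2 * x n\<close>, the
  form is \<open>(sqrt a * x n + L x / sqrt a)^2\<close> plus a form in the first \<open>n\<close>
  variables whose matrix is the Schur complement \<open>P'\<close>. Positivity passes to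
  \<open>P'\<close>, so the induction applies.\<close>

lemma sum_of_squares_representation:
  fixes P :: "nat \<Rightarrow> nat \<Rightarrow> real"
  assumes "\<And>i j. i < n \<Longrightarrow> j < n \<Longrightarrow> P i j = P j i"
    and "\<And>x. \<exists>i<n. x i \<noteq> 0 \<Longrightarrow> 0 < (\<Sum>i<n. \<Sum>j<n. x i * P i j * x j)"
  shows "\<exists>s. \<forall>x. (\<Sum>k<n. (\<Sum>j<n. s k j * x j)\<^sup>2) = (\<Sum>i<n. \<Sum>j<n. x i * P i j * x j)"
  using assms
proof (induction n arbitrary: P)
  case 0
  then show ?case by simp
next
  case (Suc n)
  define a where "a = P n n"
  define L where "L x = (\<Sum>j<n. P n j * x j)" for x :: "nat \<Rightarrow> real"
  define P' where "P' i j = P i j - P n i * P n j / a" for i j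
  let ?q = "\<lambda>n P x. \<Sum>i<n. \<Sum>j<n. x i * P i j * x j :: real"
  have a: "a > 0"
    using Suc.prems(2)[of "\<lambda>i. of_bool (i = n)"] by (auto simp: a_def of_bool_def if_distrib sum.delta cong: if_cong)
  have q': "?q n P' x = ?q n P x - (L x)\<^sup>2 / a" for x
  proof -
    have "?q n P' x = ?q n P x - (\<Sum>i<n. \<Sum>j<n. (P n i * x i) * (P n j * x j) / a)"
      unfolding sum_subtractf[symmetric] by (intro sum.cong refl) (simp add: P'_def algebra_simps)
    also have "(\<Sum>i<n. \<Sum>j<n. (P n i * x i) * (P n j * x j) / a) = (L x)\<^sup>2 / a"
      by (simp add: L_def power2_eq_square sum_product sum_divide_distrib)
    finally show ?thesis .
  qed
  have q: "?q (Suc n) P x = a * (x n)\<^sup>2 + 2 * x n * L x + ?q n P x" for x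
  proof -
    have "(\<Sum>i<n. x i * P i n * x n) = x n * L x"
      unfolding L_def sum_distrib_left by (intro sum.cong refl) (simp add: Suc.prems(1))
    moreover have "(\<Sum>i<n. x n * P n i * x i) = x n * L x"
      unfolding L_def sum_distrib_left by (intro sum.cong refl) simp
    ultimately show ?thesis
      by (simp add: sum.distrib a_def power2_eq_square)
  qed
  have "\<exists>s. \<forall>x. (\<Sum>k<n. (\<Sum>j<n. s k j * x j)\<^sup>2) = ?q n P' x"
  proof (rule Suc.IH)
    show "P' i j = P' j i" if "i < n" "j < n" for i j
      using that Suc.prems(1)[of i j] by (simp add: P'_def)
    show "0 < ?q n P' x" if "\<exists>i<n. x i \<noteq> 0" for x
    proof -
      \<comment> \<open>This last coordinate minimises the form when the others are fixed: the
        completed square vanishes and the value of the \<open>P'\<close> form remains.\<close>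
      define y where "y = x(n := - L x / a)"
      have Ly: "L y = L x" and qy: "?q n P y = ?q n P x"
        unfolding L_def y_def by (auto intro!: sum.cong)
      have "0 < ?q (Suc n) P y"
        by (rule Suc.prems(2)) (use that in \<open>auto simp: y_def intro: less_SucI\<close>)
      also have "\<dots> = ?q n P' x"
        unfolding q q' Ly qy using a by (simp add: y_def power2_eq_square field_simps)
      finally show ?thesis .
    qed
  qed
  then obtain s where s: "\<And>x. (\<Sum>k<n. (\<Sum>j<n. s k j * x j)\<^sup>2) = ?q n P' x" by blast
  \<comment> \<open>Row \<open>n\<close> is the completed square; the other rows come from the
    induction hypothesis and vanish in the last column.\<close>
  define t where "t k j = (if k = n then (if j = n then sqrt a else P n j / sqrt a)
      else if j = n then 0 else s k j)" for k j
  have "(\<Sum>k<Suc n. (\<Sum>j<Suc n. t k j * x j)\<^sup>2) = ?q (Suc n) P x" for x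
  proof -
    have "(\<Sum>j<Suc n. t n j * x j) = sqrt a * x n + L x / sqrt a"
      unfolding L_def sum_divide_distrib by (simp add: t_def)
    moreover have "(\<Sum>k<n. (\<Sum>j<Suc n. t k j * x j)\<^sup>2) = ?q n P' x"
      unfolding s[symmetric] by (intro sum.cong refl) (simp add: t_def)
    ultimately have "(\<Sum>k<Suc n. (\<Sum>j<Suc n. t k j * x j)\<^sup>2)
        = ?q n P' x + (sqrt a * x n + L x / sqrt a)\<^sup>2"
      by (simp del: sum.lessThan_Suc add: sum.lessThan_Suc[of _ n])
    also have "(sqrt a * x n + L x / sqrt a)\<^sup>2 = a * (x n)\<^sup>2 + 2 * x n * L x + (L x)\<^sup>2 / a"
      using a by (simp add: power2_sum power_mult_distrib power_divide)
    finally show ?thesis unfolding q q' by simp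
  qed
  then show ?case by blast
qed

section \<open>Polar decomposition\<close>

text \<open>Tychonoff's theorem in the product topology on functions. It supplies the compactness
  for the maximisation of the trace.\<close>

lemma compact_unit_cube: "compact {U :: 'i \<Rightarrow> real. \<forall>p. U p \<in> {-1..1}}"
proof -
  have "compactin (product_topology (\<lambda>_. euclidean) (UNIV :: 'i set)) (PiE UNIV (\<lambda>_. {-1..1::real}))"
    by (subst compactin_PiE) auto
  then have "compact (PiE (UNIV :: 'i set) (\<lambda>_. {-1..1::real}))"
    by (simp add: euclidean_product_topology)
  moreover have "PiE (UNIV :: 'i set) (\<lambda>_. {-1..1::real}) = {U. \<forall>p. U p \<in> {-1..1}}"
    by (auto simp: PiE_def)
  ultimately show ?thesis by metis
qed

lemma sum_of_bool_eq_mult: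
  fixes f :: "'a \<Rightarrow> 'b :: semiring_1"
  assumes "finite A" "i \<in> A"
  shows "(\<Sum>k\<in>A. of_bool (i = k) * f k) = f i" "(\<Sum>k\<in>A. of_bool (k = i) * f k) = f i"
proof -
  have "(\<Sum>k\<in>A. of_bool (i = k) * f k) = (\<Sum>k\<in>A. if i = k then f k else 0)"
    by (intro sum.cong) auto
  then show "(\<Sum>k\<in>A. of_bool (i = k) * f k) = f i" using assms by simp
  then show "(\<Sum>k\<in>A. of_bool (k = i) * f k) = f i" by (simp only: eq_commute[of _ i])
qed

section \<open>Maximising the trace over orthogonal matrices\<close>

definition tr :: "real mat \<Rightarrow> real" where
  "tr A = (\<Sum>i<dim_row A. A $$ (i,i))"

lemma index_mult_mat_sum:
  assumes "A \<in> carrier_mat n m" "B \<in> carrier_mat m k" "i < n" "j < k"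
  shows "(A * B) $$ (i,j) = (\<Sum>l<m. A $$ (i,l) * B $$ (l,j))"
  using assms by (simp add: scalar_prod_def atLeast0LessThan)

text \<open>A continuous function attains its maximum on a compact set. Matrices are represented by
  functions on pairs of indices, where the cube is compact and the coordinates are continuous;
  \<open>mat n n\<close> reads off the leading n by n part.\<close>

lemma orthogonal_max_trace:
  fixes M :: "real mat"
  assumes M: "M \<in> carrier_mat n n"
  obtains U where "U \<in> carrier_mat n n" "U\<^sup>T * U = 1\<^sub>m n"
    "\<And>V. V \<in> carrier_mat n n \<Longrightarrow> V\<^sup>T * V = 1\<^sub>m n \<Longrightarrow> tr (V\<^sup>T * M) \<le> tr (U\<^sup>T * M)"
proof -
  let ?mat = "\<lambda>f :: nat \<times> nat \<Rightarrow> real. mat n n f"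
  let ?g = "\<lambda>f k l. \<Sum>m<n. f (m,k) * f (m,l) :: real"
  let ?t = "\<lambda>f. \<Sum>i<n. \<Sum>m<n. f (m,i) * M $$ (m,i) :: real"
  \<comment> \<open>The Gram equations constrain only entries with both indices below
    \<open>n\<close>; the cube keeps the remaining coordinates bounded.\<close>
  define K where "K = {f :: nat \<times> nat \<Rightarrow> real. \<forall>p. f p \<in> {-1..1}} \<inter>
     (\<Inter>k\<in>{..<n}. \<Inter>l\<in>{..<n}. {f. ?g f k l = of_bool (k = l)})"
  have cont: "continuous_on UNIV (\<lambda>f. ?g f k l)" for k l
    by (intro continuous_intros continuous_on_product_coordinates)
  have cl: "closed {f. ?g f k l = of_bool (k = l)}" for k l
    by (rule closed_Collect_eq[OF cont]) simp
  have "compact K"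
    unfolding K_def by (intro compact_Int_closed compact_unit_cube closed_INT ballI cl)
  moreover have "(\<lambda>(k,l). of_bool (k = l)) \<in> K"
    by (auto simp: K_def)
  moreover have "continuous_on K ?t"
    by (intro continuous_intros continuous_on_subset[OF continuous_on_product_coordinates]) auto
  ultimately obtain f where f: "f \<in> K" "\<And>g. g \<in> K \<Longrightarrow> ?t g \<le> ?t f"
    using continuous_attains_sup[of K ?t] by blast
  have orth: "(?mat f)\<^sup>T * ?mat f = 1\<^sub>m n \<longleftrightarrow> (\<forall>k<n. \<forall>l<n. ?g f k l = of_bool (k = l))" for f
    by (auto simp: mat_eq_iff index_mult_mat_sum[of _ n n _ n] simp del: index_mult_mat(1))
  have t: "tr ((?mat f)\<^sup>T * M) = ?t f" for f
    using M by (simp add: tr_def index_mult_mat_sum[of _ n n _ n] del: index_mult_mat(1))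
  show ?thesis
  proof
    show "?mat f \<in> carrier_mat n n" by simp
    show "(?mat f)\<^sup>T * ?mat f = 1\<^sub>m n"
      using f(1) unfolding orth K_def by auto
    fix V :: "real mat" assume V: "V \<in> carrier_mat n n" "V\<^sup>T * V = 1\<^sub>m n"
    \<comment> \<open>Entries outside the matrix are set to 0 so that \<open>v\<close> lies in the
      cube there; inside, the bound holds because the columns of an orthogonal matrix have norm
      one.\<close>
    define v where "v p = (if fst p < n \<and> snd p < n then V $$ p else 0)" for p
    have Vv: "V = ?mat v" using V(1) by (auto simp: v_def)
    have *: "?g v k l = of_bool (k = l)" if "k < n" "l < n" for k l
      using V(2) orth[of v] that unfolding Vv by simp
    have "v (i,k) \<in> {-1..1}" for i k
    proof (cases "i < n \<and> k < n")
      case True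
      then have "v (i,k) * v (i,k) \<le> ?g v k k"
        by (intro member_le_sum) auto
      also have "\<dots> = 1" using * True by simp
      finally have "(v (i,k))\<^sup>2 \<le> 1" by (simp add: power2_eq_square)
      then show ?thesis by (simp add: abs_square_le_1 abs_le_iff)
    qed (auto simp: v_def)
    then have "v \<in> K" using * by (auto simp: K_def)
    then show "tr (V\<^sup>T * M) \<le> tr ((?mat f)\<^sup>T * M)"
      unfolding Vv t by (rule f(2))
  qed
qed

text \<open>For a unit vector \<open>v\<close> this is the reflection \<open>I - 2 v v^T\<close> in
  the hyperplane orthogonal to \<open>v\<close>.\<close>

definition householder :: "nat \<Rightarrow> (nat \<Rightarrow> real) \<Rightarrow> real mat" where
  "householder n v = mat n n (\<lambda>(i,j). of_bool (i = j) - 2 * v i * v j)"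

lemma householder_carrier [simp]: "householder n v \<in> carrier_mat n n"
  by (simp add: householder_def)

lemma householder_mult_index:
  assumes "B \<in> carrier_mat n n" "i < n" "j < n"
  shows "(householder n v * B) $$ (i,j) = B $$ (i,j) - 2 * v i * (\<Sum>k<n. v k * B $$ (k,j))"
proof -
  have "(householder n v * B) $$ (i,j) = (\<Sum>k<n. (of_bool (i = k) - 2 * v i * v k) * B $$ (k,j))"
    using assms by (simp add: index_mult_mat_sum[of _ n n _ n]) (simp add: householder_def)
  also have "\<dots> = (\<Sum>k<n. of_bool (i = k) * B $$ (k,j)) - (\<Sum>k<n. 2 * v i * (v k * B $$ (k,j)))"
    unfolding sum_subtractf[symmetric] by (intro sum.cong refl) (simp add: algebra_simps)
  finally show ?thesis using assms by (simp add: sum_distrib_left sum_of_bool_eq_mult)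
qed

lemma householder_transpose: "(householder n v)\<^sup>T = householder n v"
  by (auto simp: householder_def)

lemma householder_square:
  assumes "(\<Sum>i<n. (v i)\<^sup>2) = 1"
  shows "householder n v * householder n v = 1\<^sub>m n"
proof (rule eq_matI)
  fix i j assume "i < dim_row (1\<^sub>m n)" "j < dim_col (1\<^sub>m n)"
  then have ij: "i < n" "j < n" by auto
  have "(\<Sum>k<n. v k * householder n v $$ (k,j)) = (\<Sum>k<n. of_bool (k = j) * v k) - 2 * v j * (\<Sum>k<n. (v k)\<^sup>2)"
    unfolding sum_distrib_left sum_subtractf[symmetric]
    using ij by (intro sum.cong refl) (simp add: householder_def algebra_simps power2_eq_square)
  also have "\<dots> = - v j" using ij assms by (simp add: sum_of_bool_eq_mult)
  finally show "(householder n v * householder n v) $$ (i,j) = 1\<^sub>m n $$ (i,j)"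
    using ij by (subst householder_mult_index[of _ n]) (auto simp: householder_def)
qed (auto simp: householder_def)

text \<open>When the identity maximises the trace, a reflection cannot increase it; this formula
  turns that into a sign condition on \<open>v^T B v\<close>.\<close>

lemma tr_householder_mult:
  assumes "B \<in> carrier_mat n n"
  shows "tr (householder n v * B) = tr B - 2 * (\<Sum>i<n. \<Sum>k<n. v i * B $$ (k,i) * v k)"
proof -
  have "tr (householder n v * B) = (\<Sum>i<n. B $$ (i,i) - 2 * (\<Sum>k<n. v i * B $$ (k,i) * v k))"
    unfolding tr_def using assms
    by (auto simp: householder_mult_index sum_distrib_left algebra_simps carrier_matD[OF householder_carrier]
         simp del: index_mult_mat(1) intro!: sum.cong)
  then show ?thesis using assms by (simp add: tr_def sum_subtractf sum_distrib_left)
qed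

text \<open>Testing with one reflection gives semidefiniteness. Testing with the product of the reflections
in \<open>e_i\<close> and in \<open>c e_i + s e_j\<close>, where \<open>t = s / c\<close>, and letting \<open>t\<close> tend to \<open>0\<close> gives symmetry.\<close>

lemma trace_maximal_imp_sym_psd:
  fixes B :: "real mat"
  assumes B: "B \<in> carrier_mat n n"
    and max: "\<And>R. R \<in> carrier_mat n n \<Longrightarrow> R\<^sup>T * R = 1\<^sub>m n \<Longrightarrow> tr (R\<^sup>T * B) \<le> tr B"
  shows "sym_psd B"
proof -
  \<comment> \<open>\<open>q v w\<close> is \<open>w^T B v\<close>; symmetry of \<open>B\<close> is
    not yet known, so the order of the arguments matters.\<close>
  define q where "q v w = (\<Sum>i<n. \<Sum>k<n. v i * B $$ (k,i) * w k)" for v w :: "nat \<Rightarrow> real"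
  have refl1: "0 \<le> q v v" if "(\<Sum>i<n. (v i)\<^sup>2) = 1" for v
    using max[of "householder n v"] householder_square[OF that]
    by (simp add: householder_transpose tr_householder_mult[OF B] q_def)
  \<comment> \<open>The competitor is a product of two reflections: expanding the trace gives
    \<open>tr B - 2 q w w - 2 q v v + 4 <v,w> q v w\<close>, which is at most \<open>tr B\<close> by
    maximality.\<close>
  have refl2: "2 * (\<Sum>i<n. v i * w i) * q v w \<le> q v v + q w w"
    if vw: "(\<Sum>i<n. (v i)\<^sup>2) = 1" "(\<Sum>i<n. (w i)\<^sup>2) = 1" for v w
  proof -
    let ?V = "householder n v" and ?W = "householder n w"
    have tR: "(?W * ?V)\<^sup>T = ?V * ?W"
      by (subst transpose_mult[of _ n n _ n]) (simp_all add: householder_transpose)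
    have c: "?W * ?V \<in> carrier_mat n n" by (rule mult_carrier_mat[of _ n n]) simp_all
    have "?V * ?W * (?W * ?V) = ?V * (?W * (?W * ?V))"
      by (rule assoc_mult_mat[of _ n n _ n, OF _ _ c]) simp_all
    also have "?W * (?W * ?V) = ?W * ?W * ?V"
      by (rule assoc_mult_mat[of _ n n _ n _ n, symmetric]) simp_all
    also have "\<dots> = ?V"
      unfolding householder_square[OF vw(2)] by (rule left_mult_one_mat[of _ n n]) simp
    also have "?V * ?V = 1\<^sub>m n" by (rule householder_square[OF vw(1)])
    finally have "(?W * ?V)\<^sup>T * (?W * ?V) = 1\<^sub>m n" unfolding tR .
    from max[OF c this] have "tr (?V * ?W * B) \<le> tr B" unfolding tR .
    then have "tr (?V * (?W * B)) \<le> tr B"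
      by (subst (asm) assoc_mult_mat[of _ n n _ n, OF _ _ B]) simp_all
    moreover have "tr (?V * (?W * B)) = tr (?W * B) - 2 * (\<Sum>i<n. \<Sum>k<n. v i * (?W * B) $$ (k,i) * v k)"
      by (rule tr_householder_mult, rule mult_carrier_mat[OF _ B]) simp
    moreover have "(\<Sum>i<n. \<Sum>k<n. v i * (?W * B) $$ (k,i) * v k) = q v v - 2 * (\<Sum>i<n. v i * w i) * q v w"
    proof -
      have "(\<Sum>i<n. \<Sum>k<n. v i * (?W * B) $$ (k,i) * v k)
        = (\<Sum>i<n. (\<Sum>k<n. v i * B $$ (k,i) * v k) - 2 * (\<Sum>k<n. v k * w k) * (\<Sum>l<n. v i * B $$ (l,i) * w l))"
      proof (intro sum.cong refl)
        fix i assume "i \<in> {..<n}"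
        then have "(\<Sum>k<n. v i * (?W * B) $$ (k,i) * v k)
          = (\<Sum>k<n. v i * B $$ (k,i) * v k - (v k * w k) * (2 * (\<Sum>l<n. v i * B $$ (l,i) * w l)))"
          by (intro sum.cong refl) (simp add: householder_mult_index[OF B] algebra_simps sum_distrib_left del: index_mult_mat(1))
        then show "(\<Sum>k<n. v i * (?W * B) $$ (k,i) * v k)
          = (\<Sum>k<n. v i * B $$ (k,i) * v k) - 2 * (\<Sum>k<n. v k * w k) * (\<Sum>l<n. v i * B $$ (l,i) * w l)"
          unfolding sum_subtractf sum_distrib_right[symmetric] by (simp only: mult.assoc mult.commute mult.left_commute)
      qed
      then show ?thesis
        by (simp add: q_def sum_subtractf sum_distrib_left[symmetric] del: index_mult_mat(1))
    qed
    ultimately show ?thesis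
      using tr_householder_mult[OF B, of w] by (simp add: q_def)
  qed
  \<comment> \<open>One inequality for all ordered pairs suffices, since exchanging \<open>i\<close>
    and \<open>j\<close> gives the reverse one.\<close>
  have half: "B $$ (j,i) \<le> B $$ (i,j)" if ij: "i < n" "j < n" "i \<noteq> j" for i j
  proof -
    let ?v = "\<lambda>k. of_bool (k = i) :: real"
    have ineq: "t * (B $$ (j,i) - B $$ (i,j)) \<le> t\<^sup>2 * (B $$ (i,i) + B $$ (j,j))" for t :: real
    proof -
      \<comment> \<open>Cosine and sine of the angle with tangent \<open>t\<close>, so that
        \<open>w\<close> is a unit vector.\<close>
      define c s where "c = 1 / sqrt (1 + t\<^sup>2)" and "s = t * c"
      define w where "w k = of_bool (k = i) * c + of_bool (k = j) * s" for k
      have pos: "1 + t\<^sup>2 > 0" by (simp add: add_pos_nonneg)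
      have c2: "c\<^sup>2 * (1 + t\<^sup>2) = 1" using pos by (simp add: c_def power_divide)
      have cs: "c\<^sup>2 + s\<^sup>2 = 1" using c2 by (simp add: s_def power_mult_distrib algebra_simps)
      have sumw: "(\<Sum>k<n. f k * w k) = f i * c + f j * s" for f
      proof -
        have "(\<Sum>k<n. f k * w k) = (\<Sum>k<n. of_bool (k = i) * (f k * c)) + (\<Sum>k<n. of_bool (k = j) * (f k * s))"
          unfolding sum.distrib[symmetric] by (intro sum.cong refl) (simp add: w_def algebra_simps)
        then show ?thesis using ij by (simp add: sum_of_bool_eq_mult)
      qed
      have wi: "w i = c" "w j = s" using ij by (auto simp: w_def)
      have "(\<Sum>k<n. (w k)\<^sup>2) = (\<Sum>k<n. w k * w k)" by (simp add: power2_eq_square)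
      then have nw: "(\<Sum>k<n. (w k)\<^sup>2) = 1" unfolding sumw wi using cs by (simp add: power2_eq_square)
      have nv: "(\<Sum>k<n. (?v k)\<^sup>2) = 1"
        using sum_of_bool_eq_mult(2)[of "{..<n}" i "\<lambda>_. 1::real"] ij by (simp add: power2_eq_square)
      have vw: "(\<Sum>k<n. ?v k * w k) = c" using ij by (simp add: sumw)
      have inner: "(\<Sum>k<n. x * B $$ (k,l) * w k) = x * B $$ (i,l) * c + x * B $$ (j,l) * s" for x l
        by (rule sumw)
      have "q ?v w = (\<Sum>l<n. ?v l * (B $$ (i,l) * c + B $$ (j,l) * s))"
        unfolding q_def inner by (simp only: distrib_left mult.assoc)
      then have qvw: "q ?v w = c * B $$ (i,i) + s * B $$ (j,i)"
        using ij by (simp add: sum_of_bool_eq_mult)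
      have "(\<Sum>k<n. ?v l * B $$ (k,l) * ?v k) = (\<Sum>k<n. ?v k * (?v l * B $$ (k,l)))" for l
        by (simp only: mult.commute)
      then have "q ?v ?v = (\<Sum>l<n. ?v l * B $$ (i,l))"
        unfolding q_def using ij by (simp only: sum_of_bool_eq_mult finite_lessThan lessThan_iff)
      then have qvv: "q ?v ?v = B $$ (i,i)"
        using ij by (simp add: sum_of_bool_eq_mult)
      have "q w w = (\<Sum>l<n. (B $$ (i,l) * c + B $$ (j,l) * s) * w l)"
        unfolding q_def inner by (simp add: algebra_simps)
      then have qww: "q w w = c * c * B $$ (i,i) + c * s * (B $$ (i,j) + B $$ (j,i)) + s * s * B $$ (j,j)"
        unfolding sumw by (simp add: algebra_simps)
      have "2 * c * (c * B $$ (i,i) + s * B $$ (j,i))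
         \<le> B $$ (i,i) + (c * c * B $$ (i,i) + c * s * (B $$ (i,j) + B $$ (j,i)) + s * s * B $$ (j,j))"
        using refl2[OF nv nw] unfolding vw qvw qvv qww .
      \<comment> \<open>Making this term homogeneous of degree two in \<open>c\<close> and
        \<open>s\<close> cancels the \<open>c^2\<close> terms; after \<open>s = t * c\<close>
        everything left has the positive factor \<open>c^2\<close>.\<close>
      moreover have "B $$ (i,i) = (c\<^sup>2 + s\<^sup>2) * B $$ (i,i)" unfolding cs by simp
      ultimately have "c * s * (B $$ (j,i) - B $$ (i,j)) \<le> s\<^sup>2 * (B $$ (i,i) + B $$ (j,j))"
        by (simp add: power2_eq_square algebra_simps)
      then have "c\<^sup>2 * (t * (B $$ (j,i) - B $$ (i,j))) \<le> c\<^sup>2 * (t\<^sup>2 * (B $$ (i,i) + B $$ (j,j)))"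
        by (simp add: s_def power2_eq_square algebra_simps)
      moreover have "c\<^sup>2 > 0" using pos by (simp add: c_def)
      ultimately show ?thesis by (simp only: mult_le_cancel_left_pos)
    qed
    \<comment> \<open>An explicit small \<open>t\<close> replaces the limit: at
      \<open>t = d / e\<close> the left side of \<open>ineq\<close> is \<open>d^2 / e\<close>, while
      the right side is strictly smaller because \<open>e\<close> exceeds the sum of the two
      diagonal entries.\<close>
    define d where "d = B $$ (j,i) - B $$ (i,j)"
    define e where "e = \<bar>B $$ (i,i) + B $$ (j,j)\<bar> + 1"
    have e: "e > 0" by (simp add: e_def)
    show ?thesis
    proof (rule ccontr)
      assume "\<not> ?thesis"
      then have d: "d > 0" by (simp add: d_def)
      have "(d / e) * d \<le> (d / e)\<^sup>2 * (B $$ (i,i) + B $$ (j,j))"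
        using ineq[of "d / e"] by (simp add: d_def)
      also have "\<dots> < (d / e)\<^sup>2 * e"
        using d e by (intro mult_strict_left_mono) (auto simp: e_def)
      also have "\<dots> = (d / e) * d" using e by (simp add: power2_eq_square)
      finally show False by simp
    qed
  qed
  have "B\<^sup>T = B"
    using B by (intro eq_matI) (auto simp: order_antisym half, metis half order_antisym)
  moreover have "0 \<le> x \<bullet> (B *\<^sub>v x)" if x: "x \<in> carrier_vec n" for x
  proof -
    have eq: "x \<bullet> (B *\<^sub>v x) = q (($) x) (($) x)"
    proof -
      have "x \<bullet> (B *\<^sub>v x) = (\<Sum>k<n. \<Sum>i<n. x $ i * B $$ (k,i) * x $ k)"
        using x B by (simp add: scalar_prod_def atLeast0LessThan sum_distrib_left algebra_simps)
      then show ?thesis unfolding q_def by (subst sum.swap)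
    qed
    \<comment> \<open>The reflection bound concerns unit vectors; a nonzero \<open>x\<close> is
      normalised, which divides the form by \<open>N\<close>.\<close>
    define N where "N = (\<Sum>i<n. (x $ i)\<^sup>2)"
    show ?thesis
    proof (cases "N = 0")
      case True
      then have "\<forall>i<n. x $ i = 0" by (auto simp: N_def sum_nonneg_eq_0_iff)
      then show ?thesis unfolding eq q_def by simp
    next
      case False
      then have N: "N > 0" by (simp add: N_def order.not_eq_order_implies_strict sum_nonneg)
      have "0 \<le> q (\<lambda>i. x $ i / sqrt N) (\<lambda>i. x $ i / sqrt N)"
        using N by (intro refl1) (simp add: power_divide sum_divide_distrib[symmetric] N_def[symmetric])
      also have "\<dots> = q (($) x) (($) x) / N"
        using N by (simp add: q_def sum_divide_distrib)
      finally show ?thesis using N unfolding eq by (simp add: zero_le_divide_iff)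
    qed
  qed
  ultimately show ?thesis using B by (auto simp: sym_psd_def)
qed

text \<open>Let \<open>U\<close> maximise \<open>tr (U^T M)\<close> and put
  \<open>B = U^T M\<close>. As \<open>U R\<close> is orthogonal for every orthogonal
  \<open>R\<close>, the identity maximises the trace for \<open>B\<close>, and this makes
  \<open>B\<close> symmetric and positive semidefinite. Singular \<open>M\<close> is covered as
  well.\<close>

lemma polar_decomposition:
  fixes M :: "real mat"
  assumes M: "M \<in> carrier_mat n n"
  obtains U B where "U \<in> carrier_mat n n" "U\<^sup>T * U = 1\<^sub>m n" "B \<in> carrier_mat n n" "sym_psd B" "M = U * B"
proof -
  obtain U where U: "U \<in> carrier_mat n n" "U\<^sup>T * U = 1\<^sub>m n"
    and max: "\<And>V. V \<in> carrier_mat n n \<Longrightarrow> V\<^sup>T * V = 1\<^sub>m n \<Longrightarrow> tr (V\<^sup>T * M) \<le> tr (U\<^sup>T * M)"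
    using orthogonal_max_trace[OF M] by blast
  define B where "B = U\<^sup>T * M"
  have B: "B \<in> carrier_mat n n" using U(1) M by (simp add: B_def)
  have UB: "M = U * B"
  proof -
    have "U * U\<^sup>T = 1\<^sub>m n" using U mat_mult_left_right_inverse[of "U\<^sup>T" n U] by simp
    then have "(U * U\<^sup>T) * M = M" using M by simp
    then show ?thesis using U(1) M by (simp add: B_def)
  qed
  have max': "tr (R\<^sup>T * B) \<le> tr B" if R: "R \<in> carrier_mat n n" "R\<^sup>T * R = 1\<^sub>m n" for R
  proof -
    have eq: "(U * R)\<^sup>T = R\<^sup>T * U\<^sup>T" using U R transpose_mult by blast
    have "R\<^sup>T * U\<^sup>T * (U * R) = R\<^sup>T * ((U\<^sup>T * U) * R)"
      using U(1) R(1) by (simp add: assoc_mult_mat[of _ n n _ n _ n])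
    also have "\<dots> = 1\<^sub>m n" using U(2) R by simp
    finally have "(U * R)\<^sup>T * (U * R) = 1\<^sub>m n" unfolding eq .
    then have "tr (R\<^sup>T * U\<^sup>T * M) \<le> tr (U\<^sup>T * M)"
      using max[of "U * R"] U(1) R(1) unfolding eq by simp
    then show ?thesis using U(1) R(1) M by (simp add: B_def assoc_mult_mat[of _ n n _ n _ n])
  qed
  have "sym_psd B" by (rule trace_maximal_imp_sym_psd[OF B max'])
  then show ?thesis using that U B UB by blast
qed

section \<open>Contractions\<close>

text \<open>Written with \<open>norm\<close>, so that real and complex vectors share one
  definition.\<close>

definition sqnorm :: "'a :: real_normed_vector vec \<Rightarrow> real" where
  "sqnorm v = (\<Sum>i<dim_vec v. (norm (v $ i))\<^sup>2)"

definition contraction :: "'a :: real_normed_field mat \<Rightarrow> bool" where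
  "contraction D \<longleftrightarrow> (\<forall>x. x \<in> carrier_vec (dim_col D) \<longrightarrow> sqnorm (D *\<^sub>v x) \<le> sqnorm x)"

lemma sqnorm_append: "sqnorm (v @\<^sub>v w) = sqnorm v + sqnorm w"
proof -
  have "sqnorm (v @\<^sub>v w) = (\<Sum>i = 0..<dim_vec v. (norm (v $ i))\<^sup>2)
      + (\<Sum>i = dim_vec v..<dim_vec v + dim_vec w. (norm (w $ (i - dim_vec v)))\<^sup>2)"
    unfolding sqnorm_def lessThan_atLeast0 index_append_vec(2)
    by (subst sum.atLeastLessThan_concat[of 0 "dim_vec v" "dim_vec v + dim_vec w", symmetric]) auto
  also have "(\<Sum>i = dim_vec v..<dim_vec v + dim_vec w. (norm (w $ (i - dim_vec v)))\<^sup>2) = sqnorm w"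
    unfolding sqnorm_def lessThan_atLeast0
    using sum.shift_bounds_nat_ivl[of "\<lambda>i. (norm (w $ (i - dim_vec v)))\<^sup>2" 0 "dim_vec v" "dim_vec w"]
    by (simp add: add.commute)
  finally show ?thesis by (simp add: sqnorm_def lessThan_atLeast0)
qed

lemma contraction_four_block:
  fixes A :: "'a :: real_normed_field mat"
  assumes A: "A \<in> carrier_mat n n" "contraction A" and D: "D \<in> carrier_mat m m" "contraction D"
  shows "contraction (four_block_mat A (0\<^sub>m n m) (0\<^sub>m m n) D)"
  unfolding contraction_def
proof (intro allI impI)
  fix x :: "'a vec" assume "x \<in> carrier_vec (dim_col (four_block_mat A (0\<^sub>m n m) (0\<^sub>m m n) D))"
  then have x: "x \<in> carrier_vec (n + m)" using A D by simp
  define a d where "a = vec_first x n" and "d = vec_last x m"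
  have ad: "a \<in> carrier_vec n" "d \<in> carrier_vec m" by (auto simp: a_def d_def)
  have x_eq: "x = a @\<^sub>v d" using x by (simp add: a_def d_def)
  have "four_block_mat A (0\<^sub>m n m) (0\<^sub>m m n) D *\<^sub>v x = (A *\<^sub>v a) @\<^sub>v (D *\<^sub>v d)"
    unfolding x_eq by (rule mult_mat_vec_split[OF A(1) D(1) ad])
  then show "sqnorm (four_block_mat A (0\<^sub>m n m) (0\<^sub>m m n) D *\<^sub>v x) \<le> sqnorm x"
    using A D ad by (auto simp: x_eq sqnorm_append contraction_def intro!: add_mono)
qed

section \<open>Contractions from Jordan blocks\<close>

lemma convex_square_bound:
  assumes "0 \<le> a" "0 \<le> b" "a + b = (1::real)"
  shows "(a * x + b * y)\<^sup>2 \<le> a * x\<^sup>2 + b * y\<^sup>2"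
proof -
  have "a * x\<^sup>2 + b * y\<^sup>2 - (a * x + b * y)\<^sup>2 = a * b * (x - y)\<^sup>2"
  proof -
    have b: "b = 1 - a" using assms by simp
    show ?thesis unfolding b by (simp add: power2_eq_square algebra_simps)
  qed
  also have "\<dots> \<ge> 0" using assms by simp
  finally show ?thesis by simp
qed

text \<open>Conjugation by \<open>diag(e^i)\<close> replaces the ones above the diagonal by
  \<open>e\<close>. With \<open>e = 1 - |a|\<close>, the modulus of each entry of \<open>D x\<close>
  is at most a convex combination of the moduli of two neighbouring entries of \<open>x\<close>;
  convexity of the square and summation give the norm bound.\<close>

lemma jordan_block_similar_contraction:
  fixes a :: complex
  assumes "m \<noteq> 0" "cmod a \<le> 1" "cmod a = 1 \<Longrightarrow> m = 1"
  shows "\<exists>D \<in> carrier_mat m m. similar_mat (jordan_block m a) D \<and> contraction D"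
proof -
  \<comment> \<open>On the unit circle \<open>1 - |a|\<close> is zero and the scaling would be
    singular; there the block has size one, so any nonzero value serves.\<close>
  define e where "e = (if cmod a = 1 then 1 else complex_of_real (1 - cmod a))"
  have e0: "e \<noteq> 0" by (auto simp: e_def)
  define D where "D = mat m m (\<lambda>(i,j). if i = j then a else if Suc i = j then e else 0)"
  have D: "D \<in> carrier_mat m m" by (simp add: D_def)
  have "similar_mat_wit (jordan_block m a) D (mat_diag m (\<lambda>i. e^i)) (mat_diag m (\<lambda>i. inverse (e^i)))"
  proof (rule similar_mat_witI)
    show "jordan_block m a = mat_diag m (\<lambda>i. e^i) * D * mat_diag m (\<lambda>i. inverse (e^i))"
      using e0 by (subst mat_diag_mult_left[of _ _ m], simp add: D, subst mat_diag_mult_right[of _ m], simp)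
        (auto simp: jordan_block_def D_def field_simps intro!: eq_matI)
  qed (use e0 D in \<open>auto simp: field_simps\<close>)
  then have "similar_mat (jordan_block m a) D" unfolding similar_mat_def by blast
  moreover have "contraction D"
    unfolding contraction_def
  proof (intro allI impI)
    fix x :: "complex vec" assume "x \<in> carrier_vec (dim_col D)"
    then have x: "x \<in> carrier_vec m" by (simp add: D_def)
    \<comment> \<open>\<open>y\<close> continues \<open>x\<close> by zero, so that the last row also
      has a neighbour \<open>y (Suc i)\<close>.\<close>
    define y where "y i = (if i < m then x $ i else 0)" for i
    have Dx: "(D *\<^sub>v x) $ i = a * y i + (if Suc i < m then e else 0) * y (Suc i)" if "i < m" for i
    proof -
      have "(D *\<^sub>v x) $ i = (\<Sum>j<m. (if i = j then a else if Suc i = j then e else 0) * x $ j)"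
        using that x by (simp add: D_def scalar_prod_def atLeast0LessThan)
      also have "\<dots> = (\<Sum>j<m. (if i = j then a * x $ j else 0) + (if Suc i = j then e * x $ j else 0))"
        by (intro sum.cong) auto
      finally show ?thesis using that by (simp add: sum.distrib y_def)
    qed
    obtain k where k: "m = Suc k" using assms(1) by (cases m) auto
    let ?b = "1 - cmod a"
    have bound: "(cmod ((D *\<^sub>v x) $ i))\<^sup>2 \<le> cmod a * (cmod (y i))\<^sup>2 + ?b * (cmod (y (Suc i)))\<^sup>2" if "i < m" for i
    proof -
      have "cmod ((D *\<^sub>v x) $ i) \<le> cmod a * cmod (y i) + ?b * cmod (y (Suc i))"
      proof (cases "Suc i < m")
        case True
        then have "cmod a \<noteq> 1" using assms(3) that by auto
        then have "cmod e = ?b" using assms(2) unfolding e_def by (simp only: norm_of_real if_False)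
        then show ?thesis unfolding Dx[OF that] using True norm_triangle_ineq[of "a * y i" "e * y (Suc i)"]
          by (simp add: norm_mult)
      next
        case False
        then show ?thesis unfolding Dx[OF that] using assms(2) by (simp add: norm_mult)
      qed
      then have "(cmod ((D *\<^sub>v x) $ i))\<^sup>2 \<le> (cmod a * cmod (y i) + ?b * cmod (y (Suc i)))\<^sup>2"
        by (intro power_mono) auto
      also have "\<dots> \<le> cmod a * (cmod (y i))\<^sup>2 + ?b * (cmod (y (Suc i)))\<^sup>2"
        using assms(2) by (intro convex_square_bound) auto
      finally show ?thesis .
    qed
    have shift: "(\<Sum>i<m. (cmod (y (Suc i)))\<^sup>2) \<le> (\<Sum>i<m. (cmod (y i))\<^sup>2)"
    proof -
      have "(\<Sum>i<m. (cmod (y (Suc i)))\<^sup>2) = (\<Sum>i<k. (cmod (y (Suc i)))\<^sup>2)"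
        by (simp add: k y_def)
      also have "\<dots> \<le> (\<Sum>i<m. (cmod (y i))\<^sup>2)"
        unfolding k sum.lessThan_Suc_shift by simp
      finally show ?thesis .
    qed
    have "sqnorm (D *\<^sub>v x) = (\<Sum>i<m. (cmod ((D *\<^sub>v x) $ i))\<^sup>2)" by (simp add: sqnorm_def D_def)
    also have "\<dots> \<le> (\<Sum>i<m. cmod a * (cmod (y i))\<^sup>2 + ?b * (cmod (y (Suc i)))\<^sup>2)"
      by (intro sum_mono bound) auto
    also have "\<dots> = cmod a * (\<Sum>i<m. (cmod (y i))\<^sup>2) + ?b * (\<Sum>i<m. (cmod (y (Suc i)))\<^sup>2)"
      by (simp add: sum.distrib sum_distrib_left)
    also have "\<dots> \<le> cmod a * (\<Sum>i<m. (cmod (y i))\<^sup>2) + ?b * (\<Sum>i<m. (cmod (y i))\<^sup>2)"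
      using shift assms(2) by (intro add_left_mono mult_left_mono) auto
    also have "\<dots> = (\<Sum>i<m. (cmod (y i))\<^sup>2)" by (simp add: algebra_simps)
    also have "\<dots> = sqnorm x" using x by (auto simp: sqnorm_def y_def)
    finally show "sqnorm (D *\<^sub>v x) \<le> sqnorm x" .
  qed
  ultimately show ?thesis using D by blast
qed

lemma jordan_matrix_similar_contraction:
  fixes n_as :: "(nat \<times> complex) list"
  assumes "\<And>m a. (m,a) \<in> set n_as \<Longrightarrow> m \<noteq> 0 \<and> cmod a \<le> 1 \<and> (cmod a = 1 \<longrightarrow> m = 1)"
  shows "\<exists>D. similar_mat (jordan_matrix n_as) D \<and> contraction D"
  using assms
proof (induction n_as)
  case Nil
  have "contraction (jordan_matrix ([] :: (nat \<times> complex) list))"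
    by (auto simp: contraction_def sqnorm_def)
  then show ?case
    using similar_mat_refl[OF jordan_matrix_carrier[of "[] :: (nat \<times> complex) list"]] by blast
next
  case (Cons na n_as)
  obtain m a where na: "na = (m,a)" by force
  obtain D where D: "similar_mat (jordan_matrix n_as) D" "contraction D"
    using Cons.IH[OF Cons.prems] by auto
  obtain C where C: "C \<in> carrier_mat m m" "similar_mat (jordan_block m a) C" "contraction C"
    using jordan_block_similar_contraction[of m a] Cons.prems[of m a] na by auto
  define k where "k = sum_list (map fst n_as)"
  have J: "jordan_matrix n_as \<in> carrier_mat k k" by (simp add: k_def)
  have D': "D \<in> carrier_mat k k"
    using similar_matD[OF D(1)] J by auto
  have "similar_mat (jordan_matrix (na # n_as)) (four_block_mat C (0\<^sub>m m k) (0\<^sub>m k m) D)"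
    unfolding na jordan_matrix_Cons k_def[symmetric]
    by (rule similar_mat_four_block_0_0[OF C(2) D(1) _ J]) simp
  then show ?case using contraction_four_block[OF C(1,3) D' D(2)] by blast
qed

text \<open>Applied to the positive sizes of the Jordan blocks of one eigenvalue: the full sum is
  the algebraic multiplicity, the sum of \<open>min 1\<close> counts the blocks and is the geometric
  one. Each term dominates its truncation, so equal sums force equal terms.\<close>

lemma sum_list_min_one_eq:
  fixes xs :: "nat list"
  assumes "sum_list xs = sum_list (map (min 1) xs)" "x \<in> set xs"
  shows "x \<le> 1"
proof -
  have le: "sum_list (map (min 1) xs) \<le> sum_list xs" for xs :: "nat list"
    by (induction xs) auto
  show ?thesis using assms
  proof (induction xs)
    case (Cons y ys)
    then show ?case using le[of ys] by (cases "y \<le> 1") auto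
  qed simp
qed

text \<open>Read off the Jordan form: equal algebraic and geometric multiplicity at an eigenvalue of
  modulus one makes its blocks have size one, which is what the blockwise construction requires.
  \<open>dim_gen_eigenspace A z 1\<close> is the dimension of the ordinary eigenspace.\<close>

lemma stable_similar_contraction:
  fixes A :: "complex mat"
  assumes A: "A \<in> carrier_mat n n"
    and disc: "\<And>z. poly (char_poly A) z = 0 \<Longrightarrow> cmod z \<le> 1"
    and semi: "\<And>z. poly (char_poly A) z = 0 \<Longrightarrow> cmod z = 1 \<Longrightarrow>
      order z (char_poly A) = dim_gen_eigenspace A z 1"
  shows "\<exists>D. similar_mat A D \<and> contraction D"
proof -
  obtain as where "char_poly A = (\<Prod>a\<leftarrow>as. [:- a, 1:])"
    using char_poly_factorized[OF A] by auto
  from jordan_nf_exists[OF A this] obtain n_as where jnf: "jordan_nf A n_as" by blast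
  have "\<exists>D. similar_mat (jordan_matrix n_as) D \<and> contraction D"
  proof (rule jordan_matrix_similar_contraction)
    fix m a assume mem: "(m,a) \<in> set n_as"
    have m0: "m \<noteq> 0" using jnf mem by (force simp: jordan_nf_def)
    have "order a (char_poly A) \<noteq> 0"
      using jordan_nf_block_size_order_bound[OF jnf mem] m0 by simp
    then have root: "poly (char_poly A) a = 0" using order_root by blast
    have "m = 1" if "cmod a = 1"
    proof -
      let ?xs = "map fst (filter (\<lambda>na. snd na = a) n_as)"
      have eq: "[(n, e)\<leftarrow>n_as . e = a] = filter (\<lambda>na. snd na = a) n_as"
        by (rule filter_cong) auto
      have "sum_list ?xs = sum_list (map (min 1) ?xs)"
        using semi[OF root that] unfolding jordan_nf_order[OF jnf] dim_gen_eigenspace[OF jnf] eq .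
      moreover have "m \<in> set ?xs" using mem by force
      ultimately have "m \<le> 1" by (rule sum_list_min_one_eq)
      then show ?thesis using m0 by simp
    qed
    then show "m \<noteq> 0 \<and> cmod a \<le> 1 \<and> (cmod a = 1 \<longrightarrow> m = 1)"
      using m0 disc[OF root] by blast
  qed
  then show ?thesis
    using jnf similar_mat_trans unfolding jordan_nf_def by blast
qed

section \<open>Spectrum of a contraction\<close>

lemma sqnorm_nonneg: "0 \<le> sqnorm v"
  by (simp add: sqnorm_def sum_nonneg)

lemma sqnorm_eq_0_iff: "sqnorm v = 0 \<longleftrightarrow> v = 0\<^sub>v (dim_vec v)"
  by (auto simp: sqnorm_def sum_nonneg_eq_0_iff vec_eq_iff)

lemma sqnorm_smult:
  fixes v :: "'a :: real_normed_field vec"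
  shows "sqnorm (a \<cdot>\<^sub>v v) = (norm a)\<^sup>2 * sqnorm v"
  by (simp add: sqnorm_def norm_mult power_mult_distrib sum_distrib_left)

lemma norm_index_le_sqnorm: "i < dim_vec v \<Longrightarrow> (norm (v $ i))\<^sup>2 \<le> sqnorm v"
  unfolding sqnorm_def by (rule member_le_sum[where f = "\<lambda>i. (norm (v $ i))\<^sup>2"]) auto

lemma sqnorm_real: "sqnorm (v :: real vec) = v \<bullet> v"
  by (simp add: sqnorm_def scalar_prod_def power2_eq_square atLeast0LessThan)

lemma vec_norm2_sqnorm: "vec_norm2 v = sqrt (sqnorm v)"
  by (simp add: vec_norm2_def sqnorm_real)

lemma contraction_eigenvalue_le_1:
  fixes D :: "complex mat"
  assumes D: "D \<in> carrier_mat n n" "contraction D" and z: "poly (char_poly D) z = 0"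
  shows "cmod z \<le> 1"
proof -
  obtain v where "eigenvector D v z"
    using z eigenvalue_root_char_poly[OF D(1)] unfolding eigenvalue_def by auto
  then have v: "v \<in> carrier_vec n" "v \<noteq> 0\<^sub>v n" "D *\<^sub>v v = z \<cdot>\<^sub>v v"
    using D(1) unfolding eigenvector_def by auto
  have "sqnorm v \<noteq> 0" using v sqnorm_eq_0_iff[of v] by auto
  then have pos: "sqnorm v > 0" using sqnorm_nonneg[of v] by linarith
  have "(cmod z)\<^sup>2 * sqnorm v \<le> 1 * sqnorm v"
    using D v unfolding contraction_def by (metis mult_1 sqnorm_smult carrier_matD(2))
  then have "(cmod z)\<^sup>2 \<le> 1" using pos by simp
  then show ?thesis by (simp add: abs_square_le_1)
qed

text \<open>If \<open>w\<close> is in the kernel of the square but \<open>u = (D - z) w\<close> is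
  nonzero, then \<open>u\<close> and \<open>w\<close> form a Jordan chain, the orbit of
  \<open>w\<close> grows linearly, and the contraction bound fails.\<close>

lemma contraction_kernel_square:
  fixes D :: "complex mat"
  assumes D: "D \<in> carrier_mat n n" "contraction D" and z: "cmod z = 1"
  shows "mat_kernel (char_matrix D z ^\<^sub>m 2) = mat_kernel (char_matrix D z)"
proof -
  let ?N = "char_matrix D z"
  have N: "?N \<in> carrier_mat n n" using D by simp
  have N2: "?N ^\<^sub>m 2 = ?N * ?N"
    using N by (simp add: numeral_2_eq_2)
  have char: "?N *\<^sub>v v = D *\<^sub>v v - z \<cdot>\<^sub>v v" if "v \<in> carrier_vec n" for v
    using D(1) that unfolding char_matrix_def
    by (subst add_mult_distrib_mat_vec[of _ n n]) (auto intro!: eq_vecI)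
  have "?N *\<^sub>v w = 0\<^sub>v n" if w: "w \<in> carrier_vec n" and NNw: "?N *\<^sub>v (?N *\<^sub>v w) = 0\<^sub>v n" for w
  proof -
    define u where "u = ?N *\<^sub>v w"
    have u: "u \<in> carrier_vec n" using N w by (simp add: u_def)
    have dim: "dim_vec u = n" "dim_vec w = n" using u w by auto
    have z0: "z \<noteq> 0" using z by auto
    have Du: "D *\<^sub>v u = z \<cdot>\<^sub>v u"
      using NNw char[OF u] D u by (auto simp: u_def[symmetric] vec_eq_iff)
    have Dw: "D *\<^sub>v w = z \<cdot>\<^sub>v w + u"
      using char[OF w] D w unfolding u_def by (auto simp: vec_eq_iff)
    \<comment> \<open>Closed form of \<open>z^(-k) D^k w\<close>. Since \<open>|z| = 1\<close>,
      dividing by \<open>z\<close> preserves the norm, so no \<open>y k\<close> is longer than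
      \<open>w\<close>.\<close>
    define y where "y k = w + (of_nat k * inverse z) \<cdot>\<^sub>v u" for k :: nat
    have yc: "y k \<in> carrier_vec n" for k using u w by (simp add: y_def)
    have step: "D *\<^sub>v y k = z \<cdot>\<^sub>v y (Suc k)" for k
    proof -
      have "D *\<^sub>v y k = D *\<^sub>v w + (of_nat k * inverse z) \<cdot>\<^sub>v (D *\<^sub>v u)"
        unfolding y_def using D u w by (simp add: mult_add_distrib_mat_vec[of _ n n] mult_mat_vec[of _ n n])
      also have "\<dots> = z \<cdot>\<^sub>v y (Suc k)"
        unfolding Du Dw y_def using dim z0 by (intro eq_vecI) (auto simp: algebra_simps)
      finally show ?thesis .
    qed
    have dec: "sqnorm (y k) \<le> sqnorm w" for k
    proof (induction k)
      case 0
      have "y 0 = w" using dim by (auto simp: y_def vec_eq_iff)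
      then show ?case by simp
    next
      case (Suc k)
      have "sqnorm (y (Suc k)) = sqnorm (D *\<^sub>v y k)" unfolding step sqnorm_smult z by simp
      also have "\<dots> \<le> sqnorm (y k)" using D yc unfolding contraction_def by auto
      finally show ?case using Suc by simp
    qed
    have "u $ i = 0" if i: "i < n" for i
    proof (rule ccontr)
      assume "u $ i \<noteq> 0"
      then have pos: "cmod (u $ i) > 0" by simp
      define b where "b = sqrt (sqnorm w) + cmod (w $ i)"
      obtain k :: nat where k: "b < of_nat k * cmod (u $ i)"
        using reals_Archimedean3[OF pos] by blast
      have "(cmod (y k $ i))\<^sup>2 \<le> sqnorm w"
        using norm_index_le_sqnorm[of i "y k"] dec[of k] carrier_vecD[OF yc[of k]] i by simp
      then have "cmod (y k $ i) \<le> sqrt (sqnorm w)" by (simp add: real_le_rsqrt)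
      moreover have "y k $ i = w $ i + of_nat k * inverse z * u $ i" using dim i by (simp add: y_def)
      moreover have "of_nat k * cmod (u $ i) = cmod (of_nat k * inverse z * u $ i)"
        using z by (simp add: norm_mult norm_inverse)
      moreover have "cmod (of_nat k * inverse z * u $ i) \<le> cmod (w $ i + of_nat k * inverse z * u $ i) + cmod (w $ i)"
        using norm_triangle_ineq4[of "w $ i + of_nat k * inverse z * u $ i" "w $ i"] by simp
      ultimately show False using k unfolding b_def by simp
    qed
    then show ?thesis using dim unfolding u_def[symmetric] by (auto simp: vec_eq_iff)
  qed
  then show ?thesis
    unfolding N2 mat_kernel[OF N] mat_kernel[OF mult_carrier_mat[OF N N]] using N by auto
qed

text \<open>In the Jordan form, the kernels of the first and second power of \<open>D - z\<close>
  have as dimensions the sums of \<open>min 1\<close> and \<open>min 2\<close> over the block sizes.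
  Their equality excludes blocks of size two or more, so the number of blocks equals their total
  size, the order of the root.\<close>

lemma contraction_semisimple:
  fixes D :: "complex mat"
  assumes D: "D \<in> carrier_mat n n" "contraction D" and z: "cmod z = 1"
  shows "order z (char_poly D) = dim_gen_eigenspace D z 1"
proof -
  obtain as where "char_poly D = (\<Prod>a\<leftarrow>as. [:- a, 1:])"
    using char_poly_factorized[OF D(1)] by auto
  from jordan_nf_exists[OF D(1) this] obtain n_as where jnf: "jordan_nf D n_as" by blast
  let ?xs = "map fst (filter (\<lambda>na. snd na = z) n_as)"
  have eq: "[(n, e)\<leftarrow>n_as . e = z] = filter (\<lambda>na. snd na = z) n_as"
    by (rule filter_cong) auto
  have N: "char_matrix D z \<in> carrier_mat n n" using D by simp
  have "dim_gen_eigenspace D z 2 = dim_gen_eigenspace D z 1"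
    using contraction_kernel_square[OF assms] N
    by (simp add: dim_gen_eigenspace_def kernel_dim_def)
  then have "sum_list (map (min 2) ?xs) = sum_list (map (min 1) ?xs)"
    unfolding dim_gen_eigenspace[OF jnf] eq .
  moreover have "sum_list (map (min 2) xs) = sum_list (map (min 1) xs) \<Longrightarrow> sum_list xs = sum_list (map (min 1) xs)"
    for xs :: "nat list"
  proof (induction xs)
    case (Cons x xs)
    have "sum_list (map (min 1) xs) \<le> sum_list (map (min 2) xs)"
      by (intro sum_list_mono) auto
    moreover have "min 2 x + sum_list (map (min 2) xs) = min 1 x + sum_list (map (min 1) xs)"
      using Cons.prems by simp
    ultimately have "x \<le> 1" "sum_list (map (min 2) xs) = sum_list (map (min 1) xs)"
      by linarith+
    then show ?case using Cons.IH by simp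
  qed simp
  ultimately show ?thesis unfolding jordan_nf_order[OF jnf] dim_gen_eigenspace[OF jnf] eq by blast
qed

text \<open>A real matrix acts separately on real and imaginary parts, and the squared norm is the
  sum of theirs.\<close>

lemma contraction_of_real:
  assumes M: "M \<in> carrier_mat n n" "contraction M"
  shows "contraction (map_mat complex_of_real M)"
  unfolding contraction_def
proof (intro allI impI)
  fix x :: "complex vec" assume "x \<in> carrier_vec (dim_col (map_mat complex_of_real M))"
  then have x: "x \<in> carrier_vec n" using M by simp
  have split: "sqnorm v = sqnorm (map_vec Re v) + sqnorm (map_vec Im v)" for v
    by (simp add: sqnorm_def cmod_power2 sum.distrib)
  have "map_vec Re (map_mat complex_of_real M *\<^sub>v x) = M *\<^sub>v map_vec Re x"
    "map_vec Im (map_mat complex_of_real M *\<^sub>v x) = M *\<^sub>v map_vec Im x"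
    using M x by (auto simp: scalar_prod_def vec_eq_iff)
  moreover have "sqnorm (M *\<^sub>v map_vec f x) \<le> sqnorm (map_vec f x)" for f :: "complex \<Rightarrow> real"
    using M x unfolding contraction_def by simp
  ultimately show "sqnorm (map_mat complex_of_real M *\<^sub>v x) \<le> sqnorm x"
    unfolding split by (auto intro!: add_mono)
qed

lemma similar_mat_wit_map_of_real:
  assumes "similar_mat_wit A B P Q"
  shows "similar_mat_wit (map_mat complex_of_real A) (map_mat complex_of_real B)
    (map_mat complex_of_real P) (map_mat complex_of_real Q)"
proof -
  let ?c = "map_mat complex_of_real"
  define n where "n = dim_row A"
  note w = similar_mat_witD[OF n_def assms]
  have "?c P * ?c Q = 1\<^sub>m n" "?c Q * ?c P = 1\<^sub>m n"
    using of_real_hom.mat_hom_mult[OF w(6,7)] of_real_hom.mat_hom_mult[OF w(7,6)]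
      of_real_hom.mat_hom_one[of n] unfolding w(1,2) by metis+
  moreover have "?c A = ?c P * ?c B * ?c Q"
    unfolding w(3) of_real_hom.mat_hom_mult[OF mult_carrier_mat[OF w(6,5)] w(7)] of_real_hom.mat_hom_mult[OF w(6,5)] ..
  ultimately show ?thesis
    using w by (intro similar_mat_witI[of _ _ n]) auto
qed

text \<open>The complexification of \<open>M\<close> is a contraction similar to that of
  \<open>J\<close>; characteristic polynomial and eigenspace dimensions are similarity
  invariants.\<close>

lemma similar_contraction_stable:
  assumes M: "M \<in> carrier_mat n n" "contraction M" and sim: "similar_mat J M"
    and z: "poly (char_poly (map_mat complex_of_real J)) z = 0"
  shows "cmod z \<le> 1"
    "cmod z = 1 \<Longrightarrow> order z (char_poly (map_mat complex_of_real J)) =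
       dim_gen_eigenspace (map_mat complex_of_real J) z 1"
proof -
  let ?c = "map_mat complex_of_real"
  have Mc: "?c M \<in> carrier_mat n n" using M by simp
  note con = contraction_of_real[OF M]
  have simc: "similar_mat (?c J) (?c M)"
    using sim unfolding similar_mat_def by (blast intro: similar_mat_wit_map_of_real)
  note eqs = char_poly_similar[OF simc] dim_gen_eigenspace_similar[OF simc]
  show "cmod z \<le> 1"
    using contraction_eigenvalue_le_1[OF Mc con] z unfolding eqs by blast
  show "order z (char_poly (?c J)) = dim_gen_eigenspace (?c J) z 1" if "cmod z = 1"
    unfolding eqs by (rule contraction_semisimple[OF Mc con that])
qed

section \<open>Spectral norm\<close>

lemma sqnorm_mult_le:
  fixes B :: "real mat"
  assumes B: "B \<in> carrier_mat n m" and x: "x \<in> carrier_vec m"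
  shows "sqnorm (B *\<^sub>v x) \<le> (\<Sum>i<n. \<Sum>j<m. (B $$ (i,j))\<^sup>2) * sqnorm x"
proof -
  have "sqnorm (B *\<^sub>v x) = (\<Sum>i<n. (\<Sum>j<m. B $$ (i,j) * x $ j)\<^sup>2)"
    using B x by (simp add: sqnorm_def scalar_prod_def atLeast0LessThan)
  also have "\<dots> \<le> (\<Sum>i<n. (\<Sum>j<m. (B $$ (i,j))\<^sup>2) * (\<Sum>j<m. (x $ j)\<^sup>2))"
    by (intro sum_mono Cauchy_Schwarz_ineq_sum)
  also have "\<dots> = (\<Sum>i<n. \<Sum>j<m. (B $$ (i,j))\<^sup>2) * sqnorm x"
    using x by (simp add: sqnorm_def sum_distrib_right)
  finally show ?thesis .
qed

text \<open>The Frobenius bound \<open>sqnorm_mult_le\<close> makes the set in the definition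
  bounded above, so its \<open>Sup\<close> dominates every member; homogeneity extends the estimate
  from the unit ball to all vectors. Conversely, the set is nonempty and a contraction bounds each
  member by one.\<close>

lemma spectral_norm_le_1_iff:
  assumes B: "B \<in> carrier_mat n n"
  shows "spectral_norm B \<le> 1 \<longleftrightarrow> contraction B"
proof
  let ?S = "{vec_norm2 (B *\<^sub>v x) | x. x \<in> carrier_vec (dim_col B) \<and> vec_norm2 x \<le> 1}"
  assume le: "spectral_norm B \<le> 1"
  show "contraction B"
    unfolding contraction_def
  proof (intro allI impI)
    fix x :: "real vec" assume "x \<in> carrier_vec (dim_col B)"
    then have x: "x \<in> carrier_vec n" using B by simp
    show "sqnorm (B *\<^sub>v x) \<le> sqnorm x"
    \<comment> \<open>The zero vector cannot be normalised; the Frobenius bound settles it.\<close>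
    proof (cases "sqnorm x = 0")
      case True
      then show ?thesis using sqnorm_mult_le[OF B x] by simp
    next
      case False
      then have pos: "sqnorm x > 0" using sqnorm_nonneg[of x] by linarith
      define y where "y = (1 / sqrt (sqnorm x)) \<cdot>\<^sub>v x"
      have y: "y \<in> carrier_vec n" using x by (simp add: y_def)
      have "sqnorm y = 1" using pos by (simp add: y_def sqnorm_smult power_divide)
      moreover have "bdd_above ?S"
      proof (rule bdd_aboveI)
        fix t assume "t \<in> ?S"
        then obtain w where w: "t = vec_norm2 (B *\<^sub>v w)" "w \<in> carrier_vec n" "vec_norm2 w \<le> 1"
          using B by auto
        then have "sqnorm w \<le> 1" by (simp add: vec_norm2_sqnorm)
        then have "(\<Sum>i<n. \<Sum>j<n. (B $$ (i,j))\<^sup>2) * sqnorm w \<le> (\<Sum>i<n. \<Sum>j<n. (B $$ (i,j))\<^sup>2) * 1"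
          by (intro mult_left_mono sum_nonneg) auto
        then show "t \<le> sqrt (\<Sum>i<n. \<Sum>j<n. (B $$ (i,j))\<^sup>2)"
          unfolding w(1) vec_norm2_sqnorm using sqnorm_mult_le[OF B w(2)] by simp
      qed
      ultimately have "vec_norm2 (B *\<^sub>v y) \<le> spectral_norm B"
        unfolding spectral_norm_def using y B by (intro cSup_upper) (auto simp: vec_norm2_sqnorm)
      then have "sqrt (sqnorm (B *\<^sub>v y)) \<le> 1"
        using le unfolding vec_norm2_sqnorm by (rule order_trans)
      then have "sqnorm (B *\<^sub>v y) \<le> 1" by simp
      moreover have "B *\<^sub>v y = (1 / sqrt (sqnorm x)) \<cdot>\<^sub>v (B *\<^sub>v x)"
        unfolding y_def by (rule mult_mat_vec[OF B x])
      ultimately show ?thesis using pos by (simp add: sqnorm_smult power_divide)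
    qed
  qed
next
  assume con: "contraction B"
  show "spectral_norm B \<le> 1"
    unfolding spectral_norm_def
  proof (rule cSup_least)
    have "vec_norm2 (B *\<^sub>v 0\<^sub>v n) \<in> {vec_norm2 (B *\<^sub>v x) | x. x \<in> carrier_vec (dim_col B) \<and> vec_norm2 x \<le> 1}"
      using B by (intro CollectI exI[of _ "0\<^sub>v n"]) (simp add: vec_norm2_def)
    then show "{vec_norm2 (B *\<^sub>v x) | x. x \<in> carrier_vec (dim_col B) \<and> vec_norm2 x \<le> 1} \<noteq> {}" by blast
  next
    fix t assume "t \<in> {vec_norm2 (B *\<^sub>v x) | x. x \<in> carrier_vec (dim_col B) \<and> vec_norm2 x \<le> 1}"
    then obtain x where x: "t = vec_norm2 (B *\<^sub>v x)" "x \<in> carrier_vec (dim_col B)" "vec_norm2 x \<le> 1" by blast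
    then show "t \<le> 1"
      using con unfolding contraction_def vec_norm2_sqnorm by (meson order_trans real_sqrt_le_iff)
  qed
qed

lemma orthogonal_sqnorm:
  fixes U :: "real mat"
  assumes U: "U \<in> carrier_mat n n" "U\<^sup>T * U = 1\<^sub>m n" and x: "x \<in> carrier_vec n"
  shows "sqnorm (U *\<^sub>v x) = sqnorm x"
proof -
  have Ux: "U *\<^sub>v x \<in> carrier_vec n" using U x by simp
  have "sqnorm (U *\<^sub>v x) = (U\<^sup>T *\<^sub>v (U *\<^sub>v x)) \<bullet> x"
    unfolding sqnorm_real transpose_vec_mult_scalar[OF U(1) x Ux] ..
  also have "U\<^sup>T *\<^sub>v (U *\<^sub>v x) = (U\<^sup>T * U) *\<^sub>v x"
    using U x by (intro assoc_mult_mat_vec[symmetric]) auto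
  finally show ?thesis using U x by (simp add: sqnorm_real)
qed

lemma contraction_orthogonal_mult:
  fixes U B :: "real mat"
  assumes U: "U \<in> carrier_mat n n" "U\<^sup>T * U = 1\<^sub>m n" and B: "B \<in> carrier_mat n n"
  shows "contraction (U * B) \<longleftrightarrow> contraction B"
proof -
  have "sqnorm (U * B *\<^sub>v x) = sqnorm (B *\<^sub>v x)" if "x \<in> carrier_vec n" for x
    using orthogonal_sqnorm[OF U mult_mat_vec_carrier[OF B that]] assoc_mult_mat_vec[OF U(1) B that] by simp
  then show ?thesis using B unfolding contraction_def by simp
qed

section \<open>Rank and block pencils\<close>

text \<open>The matrix is a sum of \<open>q\<close> matrices of rank at most one, and rank is
  subadditive.\<close>

lemma rank_le_sum_products:
  fixes A :: "'a :: field mat"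
  assumes "A \<in> carrier_mat n nc"
    and "\<And>i j. i < n \<Longrightarrow> j < nc \<Longrightarrow> A $$ (i,j) = (\<Sum>k<q. f k i * g k j)"
  shows "vec_space.rank n A \<le> q"
  using assms
proof (induction q arbitrary: A)
  case 0
  then have "A = 0\<^sub>m n nc" by auto
  then show ?case by (simp add: vec_space.rank_0I)
next
  case (Suc q)
  define B where "B = mat n nc (\<lambda>(i,j). \<Sum>k<q. f k i * g k j)"
  define C where "C = mat n nc (\<lambda>(i,j). f q i * g q j)"
  have BC: "B \<in> carrier_mat n nc" "C \<in> carrier_mat n nc" by (simp_all add: B_def C_def)
  have A: "A = B + C"
    using Suc.prems by (auto simp: B_def C_def)
  have "vec_space.rank n B \<le> q"
    by (rule Suc.IH[OF BC(1)]) (simp add: B_def)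
  moreover have "vec_space.rank n C \<le> 1"
    by (rule vec_space.rank_le_1_product_entries[OF BC(2)]) (simp add: C_def)
  ultimately show ?case
    using vec_space.rank_subadditive[OF BC] unfolding A by simp
qed

lemma rank_mult_le:
  fixes X :: "'a :: field mat"
  assumes X: "X \<in> carrier_mat n q" and Y: "Y \<in> carrier_mat q m"
  shows "vec_space.rank n (X * Y) \<le> q"
  using X Y by (intro rank_le_sum_products[where q = q and nc = m and f = "\<lambda>k i. X $$ (i,k)" and g = "\<lambda>k j. Y $$ (k,j)"])
    (auto simp: scalar_prod_def atLeast0LessThan)

lemma invertible_mat_det:
  fixes A :: "'a :: field mat"
  assumes A: "A \<in> carrier_mat n n"
  shows "invertible_mat A \<longleftrightarrow> det A \<noteq> 0"
proof
  assume "invertible_mat A"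
  then obtain B where B: "A * B = 1\<^sub>m n" "B * A = 1\<^sub>m (dim_row B)"
    using A unfolding invertible_mat_def inverts_mat_def by auto
  \<comment> \<open>\<open>inverts_mat\<close> does not fix the shape of \<open>B\<close>; comparing
    dimensions in the two products does.\<close>
  have "dim_col B = n" using arg_cong[OF B(1), of dim_col] by simp
  moreover have "dim_row B = n" using arg_cong[OF B(2), of dim_col] A by simp
  ultimately have "B \<in> carrier_mat n n" by (intro carrier_matI)
  then have "det A * det B = 1"
    using B(1) det_mult[OF A, of B] by simp
  then show "det A \<noteq> 0" by auto
next
  assume "det A \<noteq> 0"
  from det_non_zero_imp_unit[OF A this, of "()"]
  obtain B where "B \<in> carrier_mat n n" "A * B = 1\<^sub>m n" "B * A = 1\<^sub>m n"
    unfolding Units_def ring_mat_def by auto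
  then show "invertible_mat A"
    using A by (auto simp: invertible_mat_def inverts_mat_def intro!: exI[of _ B])
qed

lemma invertible_matE:
  fixes A :: "'a :: field mat"
  assumes A: "A \<in> carrier_mat n n" and "invertible_mat A"
  obtains B where "B \<in> carrier_mat n n" "A * B = 1\<^sub>m n" "B * A = 1\<^sub>m n"
proof -
  have "det A \<noteq> 0" using assms invertible_mat_det by blast
  from det_non_zero_imp_unit[OF A this, of "()"]
  show ?thesis using that unfolding Units_def ring_mat_def by auto
qed

lemma assoc_mult_mat4:
  assumes "A \<in> carrier_mat n1 n2" "B \<in> carrier_mat n2 n3" "C \<in> carrier_mat n3 n4" "D \<in> carrier_mat n4 n5"
  shows "A * (B * C) * D = (A * B) * (C * D)"
  unfolding assoc_mult_mat[OF assms(1-3), symmetric]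
  by (rule assoc_mult_mat[OF mult_carrier_mat[OF assms(1,2)] assms(3,4)])

text \<open>The two complementary projections factor through dimensions \<open>q\<close> and
  \<open>n - q\<close>, which bounds both ranks from above. They add up to the identity, so the two
  products add up to \<open>W * T\<close> of rank \<open>n\<close>, and subadditivity leaves no
  slack.\<close>

lemma rank_equivalence_block:
  fixes W T :: "'a :: field mat"
  assumes W: "W \<in> carrier_mat n n" "det W \<noteq> 0" and T: "T \<in> carrier_mat n n" "det T \<noteq> 0" and q: "q \<le> n"
  shows "vec_space.rank n (W * four_block_mat (1\<^sub>m q) (0\<^sub>m q (n-q)) (0\<^sub>m (n-q) q) (0\<^sub>m (n-q) (n-q)) * T) = q"
proof -
  let ?D = "four_block_mat (1\<^sub>m q) (0\<^sub>m q (n-q)) (0\<^sub>m (n-q) q) (0\<^sub>m (n-q) (n-q)) :: 'a mat"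
  let ?D' = "four_block_mat (0\<^sub>m q q) (0\<^sub>m q (n-q)) (0\<^sub>m (n-q) q) (1\<^sub>m (n-q)) :: 'a mat"
  have D: "?D \<in> carrier_mat n n" "?D' \<in> carrier_mat n n"
    using q four_block_carrier_mat[of "1\<^sub>m q :: 'a mat" q q "0\<^sub>m (n-q) (n-q)"]
      four_block_carrier_mat[of "0\<^sub>m q q :: 'a mat" q q "1\<^sub>m (n-q)"] by auto
  have "?D = mat n q (\<lambda>(i,j). of_bool (i = j)) * mat q n (\<lambda>(i,j). of_bool (i = j))"
    (is "_ = ?a * ?b")
  proof (rule eq_matI)
    fix i j assume "i < dim_row (?a * ?b)" "j < dim_col (?a * ?b)"
    then have ij: "i < n" "j < n" by auto
    have "(?a * ?b) $$ (i,j) = (\<Sum>k<q. of_bool (i = k) * of_bool (k = j))"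
      using ij by (simp add: scalar_prod_def atLeast0LessThan)
    also have "\<dots> = (\<Sum>k<q. if k = i then of_bool (i = j) else 0)" by (intro sum.cong) auto
    also have "\<dots> = (if i < q then of_bool (i = j) else 0)" by simp
    also have "\<dots> = ?D $$ (i,j)" using ij q by auto
    finally show "?D $$ (i,j) = (?a * ?b) $$ (i,j)" by simp
  qed (use q in auto)
  moreover have "W * (?a * ?b) * T = (W * ?a) * (?b * T)"
    by (rule assoc_mult_mat4[of _ n n _ q _ n _ n]) (use W T in simp_all)
  moreover have "vec_space.rank n ((W * ?a) * (?b * T)) \<le> q"
    by (rule rank_mult_le[OF mult_carrier_mat[OF W(1)] mult_carrier_mat[OF _ T(1)]]) simp_all
  ultimately have le1: "vec_space.rank n (W * ?D * T) \<le> q"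
    by (simp only:)
  define p where "p = n - q"
  have "?D' = mat n p (\<lambda>(i,j). of_bool (i = q + j)) * mat p n (\<lambda>(i,j). of_bool (q + i = j))"
    (is "_ = ?c * ?d")
  proof (rule eq_matI)
    fix i j assume "i < dim_row (?c * ?d)" "j < dim_col (?c * ?d)"
    then have ij: "i < n" "j < n" by auto
    have "(?c * ?d) $$ (i,j) = (\<Sum>k<p. of_bool (i = q + k) * of_bool (q + k = j))"
      using ij by (simp add: scalar_prod_def atLeast0LessThan)
    \<comment> \<open>The subtraction truncates to 0 for \<open>i < q\<close>; the guard
      \<open>q \<le> i\<close> removes that spurious term.\<close>
    also have "\<dots> = (\<Sum>k<p. if k = i - q then of_bool (q \<le> i \<and> i = j) else 0)" by (intro sum.cong) auto
    also have "\<dots> = of_bool (q \<le> i \<and> i = j)" using ij q by (auto simp: p_def)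
    also have "\<dots> = ?D' $$ (i,j)" using ij q by auto
    finally show "?D' $$ (i,j) = (?c * ?d) $$ (i,j)" by simp
  qed (use q in auto)
  moreover have "W * (?c * ?d) * T = (W * ?c) * (?d * T)"
    by (rule assoc_mult_mat4[of _ n n _ p _ n _ n]) (use W T in simp_all)
  moreover have "vec_space.rank n ((W * ?c) * (?d * T)) \<le> p"
    by (rule rank_mult_le[OF mult_carrier_mat[OF W(1)] mult_carrier_mat[OF _ T(1)]]) simp_all
  ultimately have le2: "vec_space.rank n (W * ?D' * T) \<le> n - q"
    by (simp only: p_def[symmetric])
  have "?D + ?D' = 1\<^sub>m n" using q by (intro eq_matI) auto
  then have "W * ?D * T + W * ?D' * T = W * T"
    using W T D by (simp add: add_mult_distrib_mat[of _ n n _ _ n, symmetric] mult_add_distrib_mat[of _ n n _ n, symmetric])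
  moreover have "vec_space.rank n (W * T) = n"
    using W T by (intro vec_space.low_rank_det_zero) (auto simp: det_mult)
  moreover have "vec_space.rank n (W * ?D * T + W * ?D' * T) \<le> vec_space.rank n (W * ?D * T) + vec_space.rank n (W * ?D' * T)"
    using W T D by (intro vec_space.rank_subadditive) auto
  ultimately have "n \<le> vec_space.rank n (W * ?D * T) + vec_space.rank n (W * ?D' * T)" by simp
  with le1 le2 q show ?thesis by linarith
qed

section \<open>Pencils in block form\<close>

lemma smult_minus_distrib_mult_mat:
  fixes x :: "'a :: comm_ring_1"
  assumes W: "W \<in> carrier_mat n n" and F: "F \<in> carrier_mat n n" and G: "G \<in> carrier_mat n n"
    and T: "T \<in> carrier_mat n n"
  shows "x \<cdot>\<^sub>m (W * F * T) - W * G * T = W * (x \<cdot>\<^sub>m F - G) * T"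
proof -
  have xF: "x \<cdot>\<^sub>m F \<in> carrier_mat n n" using F by simp
  have "W * (x \<cdot>\<^sub>m F - G) * T = (W * (x \<cdot>\<^sub>m F) - W * G) * T"
    by (simp only: mult_minus_distrib_mat[OF W xF G])
  also have "\<dots> = W * (x \<cdot>\<^sub>m F) * T - W * G * T"
    by (rule minus_mult_distrib_mat[OF mult_carrier_mat[OF W xF] mult_carrier_mat[OF W G] T])
  also have "W * (x \<cdot>\<^sub>m F) * T = x \<cdot>\<^sub>m (W * F * T)"
    by (simp only: mult_smult_distrib[OF W F] mult_smult_assoc_mat[OF mult_carrier_mat[OF W F] T])
  finally show ?thesis by simp
qed

text \<open>With \<open>right_block\<close>, the middle factors of a Weierstrass form with
  \<open>N = 0\<close>; polymorphic because they occur over reals, complex numbers and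
  polynomials.\<close>

definition left_block :: "nat \<Rightarrow> nat \<Rightarrow> 'a :: {zero,one} mat" where
  "left_block n q = four_block_mat (1\<^sub>m q) (0\<^sub>m q (n - q)) (0\<^sub>m (n - q) q) (0\<^sub>m (n - q) (n - q))"

definition right_block :: "nat \<Rightarrow> nat \<Rightarrow> 'a :: {zero,one} mat \<Rightarrow> 'a mat" where
  "right_block n q J = four_block_mat J (0\<^sub>m q (n - q)) (0\<^sub>m (n - q) q) (1\<^sub>m (n - q))"

lemma block_carrier:
  assumes "q \<le> n" "J \<in> carrier_mat q q"
  shows "left_block n q \<in> carrier_mat n n" "right_block n q J \<in> carrier_mat n n"
  using assms four_block_carrier_mat[of "1\<^sub>m q" q q "0\<^sub>m (n - q) (n - q)" "n - q" "n - q"]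
    four_block_carrier_mat[of J q q "1\<^sub>m (n - q)" "n - q" "n - q"]
  by (auto simp: left_block_def right_block_def)

lemma block_pencil:
  fixes x :: "'a :: comm_ring_1"
  assumes "q \<le> n" "J \<in> carrier_mat q q"
  shows "x \<cdot>\<^sub>m left_block n q - right_block n q J =
    four_block_mat (x \<cdot>\<^sub>m 1\<^sub>m q - J) (0\<^sub>m q (n - q)) (0\<^sub>m (n - q) q) (- 1\<^sub>m (n - q))"
  using assms by (intro eq_matI) (auto simp: left_block_def right_block_def)

lemma map_block:
  assumes "q \<le> n" "J \<in> carrier_mat q q" "f 0 = 0" "f 1 = 1"
  shows "map_mat f (left_block n q) = left_block n q"
    "map_mat f (right_block n q J) = right_block n q (map_mat f J)"
  using assms by (auto simp: left_block_def right_block_def intro!: eq_matI)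

text \<open>The pencil is \<open>W diag(x I - J, -I) T\<close>, so its determinant is the
  characteristic polynomial of \<open>J\<close> times
  \<open>det W * (-1)^(n - q) * det T\<close>.\<close>

lemma pencil_poly_block:
  assumes q: "q \<le> n" and W: "W \<in> carrier_mat n n" and T: "T \<in> carrier_mat n n" and J: "J \<in> carrier_mat q q"
    and det: "det W \<noteq> 0" "det T \<noteq> 0"
  shows "\<exists>c. c \<noteq> 0 \<and> pencil_poly (W * left_block n q * T) (W * right_block n q J * T) = smult c (char_poly J)"
proof -
  let ?h = "\<lambda>a :: real. [:a:]"
  interpret h: comm_ring_hom ?h by unfold_locales auto
  define F where "F = (left_block n q :: real mat)"
  define G where "G = right_block n q J"
  have FG: "F \<in> carrier_mat n n" "G \<in> carrier_mat n n"
    unfolding F_def G_def by (rule block_carrier[OF q J])+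
  have hc: "map_mat ?h M \<in> carrier_mat n n" if "M \<in> carrier_mat n n" for M using that by simp
  have hom: "map_mat ?h (W * M * T) = map_mat ?h W * map_mat ?h M * map_mat ?h T" if M: "M \<in> carrier_mat n n" for M
    by (simp only: h.mat_hom_mult[OF mult_carrier_mat[OF W M] T] h.mat_hom_mult[OF W M])
  have hF: "map_mat ?h F = left_block n q" and hG: "map_mat ?h G = right_block n q (map_mat ?h J)"
    unfolding F_def G_def by (rule map_block[OF q J]; simp)+
  have hJ: "map_mat ?h J \<in> carrier_mat q q" using J by simp
  \<comment> \<open>\<open>[:0, e:]\<close> is the variable times the constant \<open>e\<close>, so
    the pencil takes the form of a scalar multiple minus a matrix over the polynomial ring.\<close>
  have "map_mat (\<lambda>e. [:0, e:]) (W * F * T) = [:0, 1:] \<cdot>\<^sub>m map_mat ?h (W * F * T)"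
    by (intro eq_matI) auto
  then have "map_mat (\<lambda>e. [:0, e:]) (W * F * T) - map_mat ?h (W * G * T)
      = map_mat ?h W * ([:0, 1:] \<cdot>\<^sub>m map_mat ?h F - map_mat ?h G) * map_mat ?h T"
    unfolding hom[OF FG(1)] hom[OF FG(2)]
    by (simp only: smult_minus_distrib_mult_mat[OF hc[OF W] hc[OF FG(1)] hc[OF FG(2)] hc[OF T]])
  also have "[:0, 1:] \<cdot>\<^sub>m map_mat ?h F - map_mat ?h G =
      four_block_mat (char_poly_matrix J) (0\<^sub>m q (n - q)) (0\<^sub>m (n - q) q) (- 1\<^sub>m (n - q))"
  proof -
    have "[:0, 1:] \<cdot>\<^sub>m 1\<^sub>m q - map_mat ?h J = char_poly_matrix J"
      using J by (auto simp: char_poly_matrix_def intro!: eq_matI)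
    then show ?thesis unfolding hF hG block_pencil[OF q hJ] by simp
  qed
  finally have eq: "map_mat (\<lambda>e. [:0, e:]) (W * F * T) - map_mat ?h (W * G * T) =
    map_mat ?h W * four_block_mat (char_poly_matrix J) (0\<^sub>m q (n - q)) (0\<^sub>m (n - q) q) (- 1\<^sub>m (n - q)) * map_mat ?h T"
    (is "_ = ?W * ?C * ?T") .
  have Jc: "char_poly_matrix J \<in> carrier_mat q q" using J by simp
  have m1: "- 1\<^sub>m (n - q) \<in> carrier_mat (n - q) (n - q)" by simp
  have C: "?C \<in> carrier_mat n n"
    using four_block_carrier_mat[OF Jc m1] q by simp
  have detC: "det ?C = char_poly J * det (- 1\<^sub>m (n - q))"
    unfolding char_poly_def by (rule det_four_block_mat_upper_right_zero[OF Jc _ _ m1]) simp_all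
  have detm1: "det (- 1\<^sub>m m :: real poly mat) = [:(-1) ^ m:]" for m
  proof -
    have "(- 1\<^sub>m m :: real poly mat) = map_mat ?h (- 1\<^sub>m m)" by (intro eq_matI) auto
    moreover have "(- 1\<^sub>m m :: real mat) = (- 1) \<cdot>\<^sub>m 1\<^sub>m m" by (intro eq_matI) auto
    ultimately show ?thesis by (simp only: h.hom_det det_smult) simp
  qed
  have "pencil_poly (W * F * T) (W * G * T) = det ?W * det ?C * det ?T"
    unfolding pencil_poly_def eq
    by (simp only: det_mult[OF mult_carrier_mat[OF hc[OF W] C] hc[OF T]] det_mult[OF hc[OF W] C])
  also have "\<dots> = smult (det W * (-1) ^ (n - q) * det T) (char_poly J)"
    unfolding detC detm1 h.hom_det by (simp add: mult_ac)
  finally show ?thesis using det unfolding F_def G_def by (intro exI[of _ "det W * (-1) ^ (n - q) * det T"]) simp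
qed

lemma mat_kernel_uminus:
  fixes A :: "'a :: comm_ring_1 mat"
  shows "mat_kernel (- A) = mat_kernel A"
proof -
  have "(- A) *\<^sub>v v = 0\<^sub>v (dim_row A) \<longleftrightarrow> A *\<^sub>v v = 0\<^sub>v (dim_row A)"
    if "v \<in> carrier_vec (dim_col A)" for v
  proof -
    have eq: "(- A) *\<^sub>v v = - (A *\<^sub>v v)" using that by (intro eq_vecI) auto
    show ?thesis unfolding eq by (auto simp: vec_eq_iff)
  qed
  then show ?thesis unfolding mat_kernel_def by (simp cong: conj_cong)
qed

text \<open>Multiplication by invertible matrices preserves the kernel dimension, the block
  \<open>-I\<close> contributes nothing, and \<open>z I - J\<close> is
  \<open>char_matrix J z\<close> up to sign.\<close>

lemma kernel_dim_pencil_block: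
  fixes W T J :: "'a :: field mat"
  assumes q: "q \<le> n" and W: "W \<in> carrier_mat n n" and T: "T \<in> carrier_mat n n" and J: "J \<in> carrier_mat q q"
    and det: "det W \<noteq> 0" "det T \<noteq> 0"
  shows "kernel_dim (z \<cdot>\<^sub>m (W * left_block n q * T) - W * right_block n q J * T) = dim_gen_eigenspace J z 1"
proof -
  note FG = block_carrier[OF q J]
  obtain Wi where Wi: "Wi \<in> carrier_mat n n" "Wi * W = 1\<^sub>m n"
    using invertible_matE[OF W] det invertible_mat_det[OF W] by metis
  obtain Ti where Ti: "Ti \<in> carrier_mat n n" "T * Ti = 1\<^sub>m n"
    using invertible_matE[OF T] det invertible_mat_det[OF T] by metis
  define C where "C = four_block_mat (z \<cdot>\<^sub>m 1\<^sub>m q - J) (0\<^sub>m q (n - q)) (0\<^sub>m (n - q) q) (- 1\<^sub>m (n - q))"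
  have zJ: "z \<cdot>\<^sub>m 1\<^sub>m q - J \<in> carrier_mat q q" using J by (metis minus_carrier_mat)
  have m1: "- 1\<^sub>m (n - q) \<in> carrier_mat (n - q) (n - q)" by simp
  have C: "C \<in> carrier_mat n n"
    using four_block_carrier_mat[OF zJ m1] q by (simp add: C_def)
  have "z \<cdot>\<^sub>m (W * left_block n q * T) - W * right_block n q J * T = W * C * T"
    unfolding smult_minus_distrib_mult_mat[OF W FG T] block_pencil[OF q J] C_def ..
  then have "kernel_dim (z \<cdot>\<^sub>m (W * left_block n q * T) - W * right_block n q J * T) = kernel.dim n (W * C * T)"
    using T by (simp add: kernel_dim_def)
  also have "\<dots> = kernel.dim n (W * C)"
    by (rule mat_kernel_dim_mult_eq_right[OF mult_carrier_mat[OF W C] T Ti])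
  also have "\<dots> = kernel.dim n C"
    unfolding mat_kernel_mult_eq[OF C W Wi] ..
  also have "\<dots> = kernel.dim (q + (n - q)) C" using q by simp
  also have "\<dots> = kernel.dim q (z \<cdot>\<^sub>m 1\<^sub>m q - J) + kernel.dim (n - q) (- 1\<^sub>m (n - q) :: 'a mat)"
    by (rule kernel_four_block_0_mat[OF C_def zJ m1])
  also have "kernel.dim (n - q) (- 1\<^sub>m (n - q) :: 'a mat) = 0"
    unfolding mat_kernel_uminus by (rule kernel_one_mat)
  also have "z \<cdot>\<^sub>m 1\<^sub>m q - J = - char_matrix J z"
    using J by (intro eq_matI) (auto simp: char_matrix_def)
  also have "kernel.dim q (- char_matrix J z) = kernel.dim q (char_matrix J z)"
    unfolding mat_kernel_uminus ..
  also have "\<dots> + 0 = dim_gen_eigenspace J z 1"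
    using carrier_matD(2)[OF char_matrix_closed[OF J]] by (simp add: dim_gen_eigenspace_def kernel_dim_def)
  finally show ?thesis .
qed

text \<open>A nonzero constant factor changes neither roots nor their orders, and the kernel
  dimensions agree, so stability of the pair is stability of \<open>J\<close>. Regularity holds
  because a characteristic polynomial is monic.\<close>

lemma stable_pair_block:
  assumes q: "q \<le> n" and W: "W \<in> carrier_mat n n" and T: "T \<in> carrier_mat n n" and J: "J \<in> carrier_mat q q"
    and det: "det W \<noteq> 0" "det T \<noteq> 0"
  shows "stable_pair (W * left_block n q * T) (W * right_block n q J * T) \<longleftrightarrow>
    (\<forall>z. poly (char_poly (map_mat complex_of_real J)) z = 0 \<longrightarrow> cmod z \<le> 1 \<and>
      (cmod z = 1 \<longrightarrow> order z (char_poly (map_mat complex_of_real J)) =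
        dim_gen_eigenspace (map_mat complex_of_real J) z 1))"
    (is "stable_pair ?E ?A \<longleftrightarrow> _")
  and "regular_pair (W * left_block n q * T) (W * right_block n q J * T)"
proof -
  let ?c = "map_mat complex_of_real"
  note FG = block_carrier[OF q J]
  obtain c where c: "c \<noteq> 0" "pencil_poly ?E ?A = smult c (char_poly J)"
    using pencil_poly_block[OF assms] by blast
  have p: "map_poly complex_of_real (pencil_poly ?E ?A) = smult (complex_of_real c) (char_poly (?c J))"
    unfolding c(2) of_real_hom.char_poly_hom[OF J] by (simp add: of_real_hom.map_poly_hom_smult)
  have hom: "?c (W * M * T) = ?c W * ?c M * ?c T" if M: "M \<in> carrier_mat n n" for M
    by (simp only: of_real_hom.mat_hom_mult[OF mult_carrier_mat[OF W M] T] of_real_hom.mat_hom_mult[OF W M])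
  have "kernel_dim (z \<cdot>\<^sub>m ?c ?E - ?c ?A) = dim_gen_eigenspace (?c J) z 1" for z
  proof -
    have blk: "?c (left_block n q) = left_block n q" "?c (right_block n q J) = right_block n q (?c J)"
      by (rule map_block[OF q J]; simp)+
    show ?thesis unfolding hom[OF FG(1)] hom[OF FG(2)] blk
      by (rule kernel_dim_pencil_block[OF q]) (use W T J det in \<open>auto simp: of_real_hom.hom_det\<close>)
  qed
  then show "stable_pair ?E ?A \<longleftrightarrow> (\<forall>z. poly (char_poly (?c J)) z = 0 \<longrightarrow> cmod z \<le> 1 \<and>
      (cmod z = 1 \<longrightarrow> order z (char_poly (?c J)) = dim_gen_eigenspace (?c J) z 1))"
    unfolding stable_pair_def finite_eigenvalue_def semisimple_eigenvalue_def p
    using c(1) by (auto simp: order_smult)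
  have "char_poly J \<noteq> 0" using degree_monic_char_poly[OF J] by auto
  then show "regular_pair ?E ?A" unfolding regular_pair_def c(2) using c(1) by simp
qed

section \<open>Stable real matrices\<close>

text \<open>From \<open>Q J = D Q\<close> follows \<open>|Q J y| \<le> |Q y|\<close>:
  \<open>J\<close> contracts the norm \<open>|Q y|\<close>. On real vectors its square is a positive
  definite real quadratic form, hence \<open>|S y|^2\<close> for a real \<open>S\<close>, and
  conjugation by \<open>S\<close> turns this norm into the Euclidean one.\<close>

lemma similar_contraction_imp_real:
  fixes J :: "real mat"
  assumes J: "J \<in> carrier_mat n n"
    and sim: "similar_mat (map_mat complex_of_real J) D" and con: "contraction D"
  obtains S Sinv where "S \<in> carrier_mat n n" "Sinv \<in> carrier_mat n n"
    "S * Sinv = 1\<^sub>m n" "Sinv * S = 1\<^sub>m n" "contraction (S * J * Sinv)"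
proof -
  let ?c = "map_mat complex_of_real" and ?v = "map_vec complex_of_real"
  obtain P Q where wit: "similar_mat_wit (?c J) D P Q" using sim unfolding similar_mat_def by blast
  have n: "n = dim_row (?c J)" using J by simp
  note w = similar_mat_witD[OF n wit]
  have QJ: "Q * ?c J = D * Q"
  proof -
    have "Q * ?c J = Q * (P * (D * Q))"
      unfolding w(3) using w(5,6,7) by (simp add: assoc_mult_mat[of _ n n _ n _ n])
    also have "\<dots> = Q * P * (D * Q)"
      by (rule assoc_mult_mat[OF w(7,6) mult_carrier_mat[OF w(5,7)], symmetric])
    also have "\<dots> = D * Q" unfolding w(2) by (rule left_mult_one_mat[OF mult_carrier_mat[OF w(5,7)]])
    finally show ?thesis .
  qed
  define q where "q x = sqnorm (Q *\<^sub>v ?v x)" for x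
  \<comment> \<open>The real part of the Gram matrix of the columns of \<open>Q\<close>. Its
    imaginary part is antisymmetric and drops out on real vectors, so \<open>H\<close> represents
    \<open>q\<close>.\<close>
  define H where "H i j = (\<Sum>k<n. Re (Q $$ (k,i) * cnj (Q $$ (k,j))))" for i j
  have q_sum: "q (vec n x) = (\<Sum>i<n. \<Sum>j<n. x i * H i j * x j)" for x
  proof -
    have "q (vec n x) = (\<Sum>k<n. (cmod (\<Sum>i<n. Q $$ (k,i) * of_real (x i)))\<^sup>2)"
      using w(7) by (simp add: q_def sqnorm_def scalar_prod_def atLeast0LessThan)
    also have "\<dots> = (\<Sum>k<n. \<Sum>i<n. \<Sum>j<n. x i * Re (Q $$ (k,i) * cnj (Q $$ (k,j))) * x j)"
    proof (intro sum.cong refl)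
      fix k
      let ?s = "\<Sum>i<n. Q $$ (k,i) * of_real (x i)"
      have "(cmod ?s)\<^sup>2 = Re (?s * cnj ?s)" by (simp only: complex_norm_square[symmetric] Re_complex_of_real)
      also have "\<dots> = (\<Sum>i<n. \<Sum>j<n. x i * Re (Q $$ (k,i) * cnj (Q $$ (k,j))) * x j)"
        unfolding cnj_sum sum_product Re_sum by (intro sum.cong refl) (simp add: algebra_simps)
      finally show "(cmod ?s)\<^sup>2 = (\<Sum>i<n. \<Sum>j<n. x i * Re (Q $$ (k,i) * cnj (Q $$ (k,j))) * x j)" .
    qed
    also have "\<dots> = (\<Sum>i<n. \<Sum>j<n. \<Sum>k<n. x i * Re (Q $$ (k,i) * cnj (Q $$ (k,j))) * x j)"
      by (subst sum.swap) (intro sum.cong refl sum.swap)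
    also have "\<dots> = (\<Sum>i<n. \<Sum>j<n. x i * H i j * x j)"
      unfolding H_def sum_distrib_left sum_distrib_right ..
    finally show ?thesis .
  qed
  have q_pos: "0 < q x" if x: "x \<in> carrier_vec n" "x \<noteq> 0\<^sub>v n" for x
  proof (rule ccontr)
    assume "\<not> 0 < q x"
    then have "q x = 0" using sqnorm_nonneg[of "Q *\<^sub>v ?v x"] unfolding q_def by linarith
    then have "Q *\<^sub>v ?v x = 0\<^sub>v n" using w(7) unfolding q_def sqnorm_eq_0_iff by simp
    then have "P *\<^sub>v (Q *\<^sub>v ?v x) = 0\<^sub>v n" using w(6) by (auto intro!: eq_vecI)
    moreover have "P *\<^sub>v (Q *\<^sub>v ?v x) = ?v x"
      using assoc_mult_mat_vec[OF w(6,7), of "?v x"] x w(1) by simp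
    ultimately show False using x by (auto simp: vec_eq_iff)
  qed
  have "\<exists>s. \<forall>x. (\<Sum>k<n. (\<Sum>j<n. s k j * x j)\<^sup>2) = (\<Sum>i<n. \<Sum>j<n. x i * H i j * x j)"
  proof (rule sum_of_squares_representation)
    show "H i j = H j i" for i j
      unfolding H_def by (intro sum.cong refl) (simp add: algebra_simps)
    show "0 < (\<Sum>i<n. \<Sum>j<n. x i * H i j * x j)" if "\<exists>i<n. x i \<noteq> 0" for x
      unfolding q_sum[symmetric] using that by (intro q_pos) (auto simp: vec_eq_iff)
  qed
  then obtain s where s: "\<And>x. (\<Sum>k<n. (\<Sum>j<n. s k j * x j)\<^sup>2) = (\<Sum>i<n. \<Sum>j<n. x i * H i j * x j)"
    by blast
  define S where "S = mat n n (\<lambda>(k,j). s k j)"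
  have S: "S \<in> carrier_mat n n" by (simp add: S_def)
  have sq: "sqnorm (S *\<^sub>v x) = q x" if x: "x \<in> carrier_vec n" for x
  proof -
    have "sqnorm (S *\<^sub>v x) = (\<Sum>k<n. (\<Sum>j<n. s k j * x $ j)\<^sup>2)"
      using x by (simp add: sqnorm_def S_def scalar_prod_def atLeast0LessThan)
    also have "\<dots> = q (vec n (($) x))" unfolding s q_sum ..
    also have "vec n (($) x) = x" using x by auto
    finally show ?thesis .
  qed
  \<comment> \<open>A nonzero vector killed by \<open>S\<close> would be a zero of the definite form
    \<open>q\<close>.\<close>
  have "det S \<noteq> 0"
  proof
    assume "det S = 0"
    then obtain v where v: "v \<in> carrier_vec n" "v \<noteq> 0\<^sub>v n" "S *\<^sub>v v = 0\<^sub>v n"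
      using det_0_iff_vec_prod_zero_field[OF S] by auto
    then show False using q_pos[OF v(1,2)] sq[OF v(1)] by (simp add: sqnorm_def)
  qed
  then obtain Sinv where Si: "Sinv \<in> carrier_mat n n" "S * Sinv = 1\<^sub>m n" "Sinv * S = 1\<^sub>m n"
    using invertible_matE[OF S] invertible_mat_det[OF S] by blast
  have "sqnorm (S * J * Sinv *\<^sub>v x) \<le> sqnorm x" if x: "x \<in> carrier_vec n" for x
  proof -
    define y where "y = Sinv *\<^sub>v x"
    have y: "y \<in> carrier_vec n" using Si x by (simp add: y_def)
    have yc: "?v y \<in> carrier_vec n" using y by simp
    have Sy: "S *\<^sub>v y = x"
      unfolding y_def assoc_mult_mat_vec[OF S Si(1) x, symmetric] Si(2) using x by simp
    have "S * J * Sinv *\<^sub>v x = S *\<^sub>v (J *\<^sub>v y)"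
      unfolding y_def assoc_mult_mat_vec[OF mult_carrier_mat[OF S J] Si(1) x]
      using assoc_mult_mat_vec[OF S J y] unfolding y_def .
    then have "sqnorm (S * J * Sinv *\<^sub>v x) = q (J *\<^sub>v y)" using sq J y by simp
    also have "?v (J *\<^sub>v y) = ?c J *\<^sub>v ?v y" by (rule of_real_hom.mult_mat_vec_hom[OF J y])
    then have "q (J *\<^sub>v y) = sqnorm ((Q * ?c J) *\<^sub>v ?v y)"
      unfolding q_def using assoc_mult_mat_vec[OF w(7,4) yc] by simp
    also have "\<dots> = sqnorm (D *\<^sub>v (Q *\<^sub>v ?v y))"
      unfolding QJ using assoc_mult_mat_vec[OF w(5,7) yc] by simp
    also have "\<dots> \<le> q y"
      using con w(5) mult_mat_vec_carrier[OF w(7) yc] unfolding q_def contraction_def by simp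
    also have "\<dots> = sqnorm x" using sq[OF y] Sy by simp
    finally show ?thesis .
  qed
  then have "contraction (S * J * Sinv)" using Si unfolding contraction_def by simp
  then show ?thesis using that S Si by blast
qed

text \<open>Forwards, a real conjugate \<open>S J S^-1\<close> is a contraction, and its polar
  factor \<open>B\<close> has the same norm because \<open>U\<close> is an isometry. Backwards,
  \<open>U * B\<close> is a contraction similar to \<open>J\<close>.\<close>

lemma contraction_similar_iff_stable:
  fixes J :: "real mat"
  assumes J: "J \<in> carrier_mat n n"
  shows "(\<forall>z. poly (char_poly (map_mat complex_of_real J)) z = 0 \<longrightarrow> cmod z \<le> 1 \<and>
      (cmod z = 1 \<longrightarrow> order z (char_poly (map_mat complex_of_real J)) =
        dim_gen_eigenspace (map_mat complex_of_real J) z 1)) \<longleftrightarrow>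
    (\<exists>S Sinv U B. S \<in> carrier_mat n n \<and> U \<in> carrier_mat n n \<and> B \<in> carrier_mat n n \<and>
       Sinv \<in> carrier_mat n n \<and> S * Sinv = 1\<^sub>m n \<and> Sinv * S = 1\<^sub>m n \<and> U\<^sup>T * U = 1\<^sub>m n \<and>
       sym_psd B \<and> spectral_norm B \<le> 1 \<and> J = Sinv * U * B * S)"
    (is "?stable \<longleftrightarrow> ?factors")
proof
  assume stable: ?stable
  have "map_mat complex_of_real J \<in> carrier_mat n n" using J by simp
  then obtain D where "similar_mat (map_mat complex_of_real J) D" "contraction D"
    using stable_similar_contraction stable by blast
  then obtain S Sinv where S: "S \<in> carrier_mat n n" "Sinv \<in> carrier_mat n n"
    "S * Sinv = 1\<^sub>m n" "Sinv * S = 1\<^sub>m n" "contraction (S * J * Sinv)"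
    using similar_contraction_imp_real[OF J] by blast
  have SJ: "S * J \<in> carrier_mat n n" by (rule mult_carrier_mat[OF S(1) J])
  have M: "S * J * Sinv \<in> carrier_mat n n" by (rule mult_carrier_mat[OF SJ S(2)])
  obtain U B where UB: "U \<in> carrier_mat n n" "U\<^sup>T * U = 1\<^sub>m n" "B \<in> carrier_mat n n" "sym_psd B"
    "S * J * Sinv = U * B"
    using polar_decomposition[OF M] by blast
  have "Sinv * U * B * S = Sinv * (S * J * Sinv) * S"
    unfolding UB(5) assoc_mult_mat[OF S(2) UB(1,3)] ..
  also have "Sinv * (S * J * Sinv) = J * Sinv"
    using J S(2) unfolding assoc_mult_mat[OF S(1) J S(2)]
      assoc_mult_mat[OF S(2,1) mult_carrier_mat[OF J S(2)], symmetric] S(4) by simp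
  also have "J * Sinv * S = J"
    unfolding assoc_mult_mat[OF J S(2,1)] S(4) using J by simp
  finally have "J = Sinv * U * B * S" ..
  moreover have "spectral_norm B \<le> 1"
    using S(5) unfolding UB(5) contraction_orthogonal_mult[OF UB(1,2,3)] spectral_norm_le_1_iff[OF UB(3)] .
  ultimately show ?factors using S UB by blast
next
  assume ?factors
  then obtain S Sinv U B where S: "S \<in> carrier_mat n n" "Sinv \<in> carrier_mat n n"
    "S * Sinv = 1\<^sub>m n" "Sinv * S = 1\<^sub>m n"
    and UB: "U \<in> carrier_mat n n" "U\<^sup>T * U = 1\<^sub>m n" "B \<in> carrier_mat n n" "spectral_norm B \<le> 1"
    and J_eq: "J = Sinv * U * B * S" by blast
  have M: "U * B \<in> carrier_mat n n" using UB by simp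
  have con: "contraction (U * B)"
    using UB(4) unfolding contraction_orthogonal_mult[OF UB(1,2,3)] spectral_norm_le_1_iff[OF UB(3)] .
  have "similar_mat_wit J (U * B) Sinv S"
    by (rule similar_mat_witI[OF S(4,3) _ J M S(2,1)])
      (simp only: J_eq assoc_mult_mat[OF S(2) UB(1,3)])
  then have "similar_mat J (U * B)" unfolding similar_mat_def by blast
  then show ?stable using similar_contraction_stable[OF M con] by blast
qed

section \<open>Index at most one\<close>

lemma index_le_1_iff:
  assumes E: "E \<in> carrier_mat n n" and A: "A \<in> carrier_mat n n"
  shows "(\<exists>\<nu>. pair_has_index n E A \<nu> \<and> \<nu> \<le> 1) \<longleftrightarrow>
    (\<exists>q W T J. q \<le> n \<and> W \<in> carrier_mat n n \<and> T \<in> carrier_mat n n \<and> det W \<noteq> 0 \<and> det T \<noteq> 0 \<and>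
      J \<in> carrier_mat q q \<and> E = W * left_block n q * T \<and> A = W * right_block n q J * T)"
    (is "_ \<longleftrightarrow> (\<exists>q W T J. ?form q W T J)")
proof
  assume "\<exists>\<nu>. pair_has_index n E A \<nu> \<and> \<nu> \<le> 1"
  then obtain \<nu> where \<nu>: "pair_has_index n E A \<nu>" "\<nu> \<le> 1" by blast
  show "\<exists>q W T J. ?form q W T J"
  proof (cases "invertible_mat E")
    case True
    then obtain F where F: "F \<in> carrier_mat n n" "E * F = 1\<^sub>m n"
      using invertible_matE[OF E] by blast
    have FA: "F * A \<in> carrier_mat n n" using F A by simp
    \<comment> \<open>Nonsingular \<open>E\<close> fits the form with \<open>q = n\<close>,
      \<open>W = E\<close>, \<open>T = I\<close> and \<open>J = E^-1 A\<close>; the trailing blocks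
      are empty.\<close>
    have "left_block n n = (1\<^sub>m n :: real mat)" "right_block n n (F * A) = F * A"
      using FA by (auto simp: left_block_def right_block_def intro!: eq_matI)
    moreover have "E * (F * A) = A"
      unfolding assoc_mult_mat[OF E F(1) A, symmetric] F(2) using A by simp
    ultimately have "?form n E (1\<^sub>m n) (F * A)"
      using True invertible_mat_det[OF E] E A FA by simp
    then show ?thesis by blast
  next
    case False
    then obtain q W T J N where wf: "weierstrass_form n E A q W T J N" "q < n"
      and eq: "\<nu> = (LEAST k. 1 \<le> k \<and> N ^\<^sub>m k = 0\<^sub>m (n - q) (n - q))"
      using \<nu>(1) unfolding pair_has_index_def by blast
    have N: "N \<in> carrier_mat (n - q) (n - q)" using wf(1) by (simp add: weierstrass_form_def)
    obtain k where "N ^\<^sub>m k = 0\<^sub>m (n - q) (n - q)" using wf(1) by (auto simp: weierstrass_form_def)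
    \<comment> \<open>Passing to \<open>Suc k\<close> meets the lower bound inside
      \<open>LEAST\<close>. The least exponent is then positive and at most one, which gives
      \<open>N = 0\<close>.\<close>
    then have "1 \<le> Suc k \<and> N ^\<^sub>m Suc k = 0\<^sub>m (n - q) (n - q)" using N by simp
    then have "1 \<le> \<nu> \<and> N ^\<^sub>m \<nu> = 0\<^sub>m (n - q) (n - q)"
      unfolding eq by (rule LeastI)
    then have "N ^\<^sub>m 1 = 0\<^sub>m (n - q) (n - q)" using \<nu>(2) by (metis le_antisym)
    then have "N = 0\<^sub>m (n - q) (n - q)" using N by simp
    then have "?form q W T J"
      using wf invertible_mat_det[of W n] invertible_mat_det[of T n]
      by (simp add: weierstrass_form_def left_block_def right_block_def)
    then show ?thesis by blast
  qed
next
  assume "\<exists>q W T J. ?form q W T J"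
  then obtain q W T J where f: "?form q W T J" by blast
  show "\<exists>\<nu>. pair_has_index n E A \<nu> \<and> \<nu> \<le> 1"
  proof (cases "invertible_mat E")
    case True
    then show ?thesis by (auto simp: pair_has_index_def)
  next
    case False
    \<comment> \<open>A full block would make \<open>E = W * T\<close> invertible, so a singular
      \<open>E\<close> has \<open>q < n\<close>, as the index definition demands.\<close>
    have "q \<noteq> n"
    proof
      assume "q = n"
      have "left_block n n = (1\<^sub>m n :: real mat)"
        by (auto simp: left_block_def intro!: eq_matI)
      then have "E = W * T" using f \<open>q = n\<close> right_mult_one_mat[of W n n] by simp
      then have "det E = det W * det T" using f det_mult[of W n T] by simp
      then show False using f False invertible_mat_det[OF E] by simp
    qed
    then have q: "q < n" using f by simp
    let ?N = "0\<^sub>m (n - q) (n - q) :: real mat"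
    have N1: "?N ^\<^sub>m 1 = ?N" by simp
    have "weierstrass_form n E A q W T J ?N"
      using f N1 invertible_mat_det[of W n] invertible_mat_det[of T n]
      unfolding weierstrass_form_def left_block_def right_block_def
      by (intro conjI exI[of _ 1]) auto
    moreover have "(LEAST k. 1 \<le> k \<and> ?N ^\<^sub>m k = ?N) \<le> 1"
      using N1 by (intro Least_le) simp
    ultimately show ?thesis
      using False q unfolding pair_has_index_def by blast
  qed
qed

theorem theorem3:
  fixes E A :: "real mat" and n r :: nat
  assumes "E \<in> carrier_mat n n" and "A \<in> carrier_mat n n"
    and "vec_space.rank n E = r"
  shows "admissible_pair n E A \<longleftrightarrow>
    (\<exists>T W S Sinv U B.
       T \<in> carrier_mat n n \<and> W \<in> carrier_mat n n \<and> invertible_mat T \<and> invertible_mat W \<and>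
       S \<in> carrier_mat r r \<and> U \<in> carrier_mat r r \<and> B \<in> carrier_mat r r \<and>
       Sinv \<in> carrier_mat r r \<and> S * Sinv = 1\<^sub>m r \<and> Sinv * S = 1\<^sub>m r \<and> U\<^sup>T * U = 1\<^sub>m r \<and> sym_psd B \<and> spectral_norm B \<le> 1 \<and>
       E = W * four_block_mat (1\<^sub>m r) (0\<^sub>m r (n - r)) (0\<^sub>m (n - r) r) (0\<^sub>m (n - r) (n - r)) * T \<and>
       A = W * four_block_mat (Sinv * U * B * S) (0\<^sub>m r (n - r)) (0\<^sub>m (n - r) r) (1\<^sub>m (n - r)) * T)"
    (is "_ \<longleftrightarrow> ?rhs")
proof
  assume adm: "admissible_pair n E A"
  then obtain q W T J where f: "q \<le> n" "W \<in> carrier_mat n n" "T \<in> carrier_mat n n"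
      "J \<in> carrier_mat q q" "det W \<noteq> 0" "det T \<noteq> 0"
    and EA: "E = W * left_block n q * T" "A = W * right_block n q J * T"
    using index_le_1_iff[OF assms(1,2)] unfolding admissible_pair_def by blast
  \<comment> \<open>The block size is determined by the pair: it is the rank of
    \<open>E\<close>.\<close>
  have qr: "q = r"
    using rank_equivalence_block[OF f(2,5,3,6,1)] assms(3) unfolding EA(1) left_block_def by simp
  note f = f[unfolded qr] and EA = EA[unfolded qr]
  have "stable_pair E A" using adm by (simp add: admissible_pair_def)
  then obtain S Sinv U B where
    "S \<in> carrier_mat r r" "U \<in> carrier_mat r r" "B \<in> carrier_mat r r" "Sinv \<in> carrier_mat r r"
    "S * Sinv = 1\<^sub>m r" "Sinv * S = 1\<^sub>m r" "U\<^sup>T * U = 1\<^sub>m r" "sym_psd B" "spectral_norm B \<le> 1"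
    "J = Sinv * U * B * S"
    unfolding EA stable_pair_block(1)[OF f] contraction_similar_iff_stable[OF f(4)] by blast
  moreover have "invertible_mat W" "invertible_mat T"
    using f invertible_mat_det by blast+
  ultimately show ?rhs
    using f(2,3) EA unfolding left_block_def right_block_def by blast
next
  assume ?rhs
  then obtain T W S Sinv U B where TW: "T \<in> carrier_mat n n" "W \<in> carrier_mat n n" "invertible_mat T" "invertible_mat W"
    and SUB: "S \<in> carrier_mat r r" "U \<in> carrier_mat r r" "B \<in> carrier_mat r r" "Sinv \<in> carrier_mat r r"
    "S * Sinv = 1\<^sub>m r" "Sinv * S = 1\<^sub>m r" "U\<^sup>T * U = 1\<^sub>m r" "sym_psd B" "spectral_norm B \<le> 1"
    and EA: "E = W * left_block n r * T" "A = W * right_block n r (Sinv * U * B * S) * T"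
    unfolding left_block_def right_block_def by blast
  define J where "J = Sinv * U * B * S"
  have J: "J \<in> carrier_mat r r" unfolding J_def
    by (intro mult_carrier_mat[of _ r r _ r] SUB)
  \<comment> \<open>The block sizes use truncated \<open>n - r\<close>, so this bound has to come
    from the rank.\<close>
  have r: "r \<le> n" using vec_space.rank_le_nc[OF assms(1)] assms(3) by simp
  have det: "det W \<noteq> 0" "det T \<noteq> 0" using TW invertible_mat_det by blast+
  note EA = EA[folded J_def]
  have "stable_pair E A"
    unfolding EA stable_pair_block(1)[OF r TW(2,1) J det] contraction_similar_iff_stable[OF J]
    using SUB J_def by blast
  moreover have "regular_pair E A"
    unfolding EA by (rule stable_pair_block(2)[OF r TW(2,1) J det])
  moreover have "\<exists>\<nu>. pair_has_index n E A \<nu> \<and> \<nu> \<le> 1"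
    unfolding index_le_1_iff[OF assms(1,2)] using r TW(1,2) J det EA by blast
  ultimately show "admissible_pair n E A" by (simp add: admissible_pair_def)
qed

end
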